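(* Let $X$ be a metric space, let $\alpha>0$ and $c_\alpha>0$, and let $\mu$ be a Borel regular measure over $X$ such that there exists a countable open covering of $X$ whose elements have finite $\mu$ measure. If $A\subset X$ is Borel and $\mathcal{S}_{\mu,\zeta_\alpha}$ covers $A$ finely, then $\mathfrak{s}^\alpha(\mu,\cdot)$ is a Borel function on $A$. Moreover, if $\mathcal{H}^\alpha(A)<+\infty$ and the restriction of $\mu$ to $A$ is absolutely continuous with respect to the restriction of $\mathcal{H}^\alpha$ to $A$, then for every Borel set $B\subset A$ we have $$\mu(B)=\int_B \mathfrak{s}^\alpha(\mu,x)\,d\mathcal{H}^\alpha(x).$$
   Context: "Measure over $X$" is meant in Federer's sense: an outer measure $\mu:\mathcal{P}(X)\to[0,+\infty]$ defined on all subsets of $X$. It is Borel regular if open sets are $\mu$-measurable (in Carathéodory's sense) and every $E\subset X$ is contained in a Borel set $E'$ with $\mu(E')=\mu(E)$. The restriction of $\mu$ to $A$ is $E\mapsto\mu(A\cap E)$. Let $\mathcal{F}$ be the family of all closed subsets of $X$ and define $\zeta_\alpha:\mathcal{F}\to[0,+\infty]$ by $\zeta_\alpha(S)=c_\alpha\operatorname{diam}(S)^\alpha$ (with $\operatorname{diam}\emptyset=0$). For $\delta>0$ and $R\subset X$ put $$\zeta_{\alpha,\delta}(R)=\inf\Big\{\sum_{j=0}^\infty\zeta_\alpha(E_j): E_j\in\mathcal{F},\ \operatorname{diam}(E_j)\le\delta\ \text{for all } j\in\mathbb{N},\ R\subset\bigcup_{j\in\mathbb{N}}E_j\Big\}$$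 (with $\inf\emptyset=+\infty$). The $\alpha$-dimensional Hausdorff measure is $\mathcal{H}^\alpha=\sup_{\delta>0}\zeta_{\alpha,\delta}$. Set $$\mathcal{S}_{\mu,\zeta_\alpha}=\mathcal{F}\setminus\{S\in\mathcal{F}: \zeta_\alpha(S)=\mu(S)=0\ \text{or}\ \mu(S)=\zeta_\alpha(S)=+\infty\}.$$ The family $\mathcal{S}_{\mu,\zeta_\alpha}$ covers $A$ finely if for every $x\in A$ and every $\varepsilon>0$ there exists $S\in\mathcal{S}_{\mu,\zeta_\alpha}$ with $x\in S$ and $\operatorname{diam}S<\varepsilon$. For $S\in\mathcal{S}_{\mu,\zeta_\alpha}$ let $Q_{\mu,\zeta_\alpha}(S)=+\infty$ if $\zeta_\alpha(S)=0$, $Q_{\mu,\zeta_\alpha}(S)=\mu(S)/\zeta_\alpha(S)$ if $0<\zeta_\alpha(S)<+\infty$, and $Q_{\mu,\zeta_\alpha}(S)=0$ if $\zeta_\alpha(S)=+\infty$. At each point $x$ such that sets $S\in\mathcal{S}_{\mu,\zeta_\alpha}$ containing $x$ exist with arbitrarily small diameter, define $$\mathfrak{s}^\alpha(\mu,x)=\inf_{\varepsilon>0}\ \sup\{Q_{\mu,\zeta_\alpha}(S): x\in S\in\mathcal{S}_{\mu,\zeta_\alpha},\ \operatorname{diam}S<\varepsilon\}.$$ *)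

theory Defs
  imports "HOL-Analysis.Analysis"
begin

text \<open>A measure in Federer's sense is an outer measure defined on all subsets of the space, i.e.
  \<^term>\<open>outer_measure_space UNIV \<mu>\<close>.  The library states countable subadditivity only for disjoint
  families; together with monotonicity this yields it for arbitrary countable families.\<close>

definition caratheodory_sets :: "('a set \<Rightarrow> ennreal) \<Rightarrow> 'a set set" where
  "caratheodory_sets \<phi> = lambda_system UNIV UNIV \<phi>"

definition caratheodory_measure :: "('a set \<Rightarrow> ennreal) \<Rightarrow> 'a measure" where
  "caratheodory_measure \<phi> = measure_of UNIV (caratheodory_sets \<phi>) \<phi>"

text \<open>For an outer measure the underlying triple of \<^term>\<open>caratheodory_measure \<phi>\<close> is a measure space, so
  \<^const>\<open>measure_of\<close> does not fall back to the zero measure.\<close>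

lemma caratheodory_measure_space:
  assumes "outer_measure_space UNIV \<phi>"
  shows "measure_space UNIV (caratheodory_sets \<phi>) \<phi>"
proof -
  interpret sigma_algebra UNIV "UNIV :: 'a set set"
    using sigma_algebra_Pow[of UNIV] by simp
  show ?thesis
    using caratheodory_lemma[OF assms] by (simp add: caratheodory_sets_def)
qed

lemma space_caratheodory_measure: "space (caratheodory_measure \<phi>) = UNIV"
  by (simp add: caratheodory_measure_def)

lemma sets_caratheodory_measure:
  assumes "outer_measure_space UNIV \<phi>"
  shows "sets (caratheodory_measure \<phi>) = caratheodory_sets \<phi>"
  using caratheodory_measure_space[OF assms]
  by (simp add: caratheodory_measure_def measure_space_def sigma_algebra.sigma_sets_eq)

lemma emeasure_caratheodory_measure:
  assumes "outer_measure_space UNIV \<phi>" and "E \<in> caratheodory_sets \<phi>"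
  shows "emeasure (caratheodory_measure \<phi>) E = \<phi> E"
  using caratheodory_measure_space[OF assms(1)] assms(2)
  unfolding caratheodory_measure_def
  by (intro emeasure_measure_of_sigma) (auto simp: measure_space_def)

definition borel_regular :: "('a::topological_space set \<Rightarrow> ennreal) \<Rightarrow> bool" where
  "borel_regular \<phi> \<longleftrightarrow>
    outer_measure_space UNIV \<phi> \<and>
    (\<forall>U. open U \<longrightarrow> U \<in> caratheodory_sets \<phi>) \<and>
    (\<forall>E. \<exists>E'\<in>sets borel. E \<subseteq> E' \<and> \<phi> E' = \<phi> E)"

definition outer_restriction :: "('a set \<Rightarrow> ennreal) \<Rightarrow> 'a set \<Rightarrow> 'a set \<Rightarrow> ennreal" where
  "outer_restriction \<phi> A E = \<phi> (A \<inter> E)"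

definition outer_absolutely_continuous ::
    "('a set \<Rightarrow> ennreal) \<Rightarrow> ('a set \<Rightarrow> ennreal) \<Rightarrow> bool" where
  "outer_absolutely_continuous \<psi> \<phi> \<longleftrightarrow> (\<forall>E. \<phi> E = 0 \<longrightarrow> \<psi> E = 0)"

text \<open>The library's \<^const>\<open>diameter\<close> is real-valued and meaningless on unbounded sets; here unbounded
  sets have diameter \<^term>\<open>\<infinity> :: ennreal\<close>, and the empty set has diameter 0.\<close>

definition ediam :: "'a::metric_space set \<Rightarrow> ennreal" where
  "ediam S = (SUP x\<in>S. SUP y\<in>S. ennreal (dist x y))"

definition ennreal_powr :: "ennreal \<Rightarrow> real \<Rightarrow> ennreal" where
  "ennreal_powr t a = (if t = \<infinity> then \<infinity> else ennreal (enn2real t powr a))"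

definition zeta :: "real \<Rightarrow> real \<Rightarrow> 'a::metric_space set \<Rightarrow> ennreal" where
  "zeta c \<alpha> S = ennreal c * ennreal_powr (ediam S) \<alpha>"

definition zeta_approx :: "real \<Rightarrow> real \<Rightarrow> real \<Rightarrow> 'a::metric_space set \<Rightarrow> ennreal" where
  "zeta_approx c \<alpha> \<delta> R =
    (INF E \<in> {E :: nat \<Rightarrow> 'a set. (\<forall>j. closed (E j) \<and> ediam (E j) \<le> ennreal \<delta>) \<and> R \<subseteq> (\<Union>j. E j)}.
      \<Sum>j. zeta c \<alpha> (E j))"

definition hausdorff :: "real \<Rightarrow> real \<Rightarrow> 'a::metric_space set \<Rightarrow> ennreal" where
  "hausdorff c \<alpha> R = (SUP \<delta>\<in>{0<..}. zeta_approx c \<alpha> \<delta> R)"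

definition gauge_family ::
    "('a::metric_space set \<Rightarrow> ennreal) \<Rightarrow> ('a set \<Rightarrow> ennreal) \<Rightarrow> 'a set set" where
  "gauge_family \<mu> \<zeta> =
    {S. closed S} - {S. closed S \<and> (\<zeta> S = 0 \<and> \<mu> S = 0 \<or> \<mu> S = \<infinity> \<and> \<zeta> S = \<infinity>)}"

definition covers_finely :: "'a::metric_space set set \<Rightarrow> 'a set \<Rightarrow> bool" where
  "covers_finely \<S> A \<longleftrightarrow> (\<forall>x\<in>A. \<forall>\<epsilon>>0. \<exists>S\<in>\<S>. x \<in> S \<and> ediam S < ennreal \<epsilon>)"

definition gauge_quotient ::
    "('a set \<Rightarrow> ennreal) \<Rightarrow> ('a set \<Rightarrow> ennreal) \<Rightarrow> 'a set \<Rightarrow> ennreal" where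
  "gauge_quotient \<mu> \<zeta> S = (if \<zeta> S = 0 then \<infinity> else if \<zeta> S = \<infinity> then 0 else \<mu> S / \<zeta> S)"

text \<open>At points that the gauge family does not cover finely the following is a junk value, namely 0.\<close>

definition federer_density ::
    "real \<Rightarrow> real \<Rightarrow> ('a::metric_space set \<Rightarrow> ennreal) \<Rightarrow> 'a \<Rightarrow> ennreal" where
  "federer_density c \<alpha> \<mu> x =
    (INF \<epsilon>\<in>{0<..}. SUP S\<in>{S \<in> gauge_family \<mu> (zeta c \<alpha>). x \<in> S \<and> ediam S < ennreal \<epsilon>}.
      gauge_quotient \<mu> (zeta c \<alpha>) S)"

end

theory Submission
  imports Defs
begin

text \<open>
  If the density is below \<open>t\<close> on \<open>B\<close>, then \<open>B\<close> is an increasing union of sets such that all closed sets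
  \<open>S\<close> of small diameter meeting them satisfy \<open>\<mu>(S) \<le> t \<zeta>(S)\<close>, hence \<open>\<mu>(B) \<le> t H(B)\<close>. If it exceeds \<open>t\<close> on \<open>B\<close>, a Vitali argument with closed sets
  \<open>S\<close> such that \<open>\<mu>(S) > t \<zeta>(S)\<close>, inside open sets nearly as small as \<open>B\<close>, gives \<open>t H(B) \<le> \<mu>(B)\<close>; here
  absolute continuity excludes atoms, so that these sets have positive diameter. By the Radon-Nikodym
  theorem \<open>\<mu>\<close> has a density with respect to \<open>H\<close> on \<open>A\<close>, and the two estimates show that it can differ from
  the Federer density only on a null set.
\<close>

subsection \<open>Diameter and gauge\<close>

text \<open>Nothing makes \<open>\<mu>\<close> doubling, so the enlarged sets of a Vitali argument
  cannot be controlled by \<open>\<mu>\<close>. They are controlled by \<open>zeta\<close>: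
  multiplying a diameter by 5 costs only the factor \<open>5 powr \<alpha>\<close>, and the gauges
  of the disjoint sets form a convergent series because
  \<open>t * zeta c \<alpha> S \<le> \<mu> S\<close> for each of them and \<open>\<mu>\<close> is
  finite on the surrounding open set. The enlarged sets therefore contribute a multiple of the tail,
  which vanishes in the limit; this is why the constant in the estimate is exactly \<open>t\<close>,
  as the integral formula requires. Both estimates use the density only through the comparison of
  \<open>t * zeta c \<alpha> S\<close> with \<open>\<mu> S\<close>, which for finite
  \<open>t\<close> absorbs the convention for sets of gauge 0. The comparison with the Radon-Nikodym
  density runs over rational \<open>q\<close>: on the set where one function lies below
  \<open>q\<close> and the other above it, the estimates give an inequality between integrals
  opposite to the pointwise one, and finiteness of the smaller integral makes the set null.\<close>

lemma ediam_le_iff: "ediam S \<le> d \<longleftrightarrow> (\<forall>x\<in>S. \<forall>y\<in>S. ennreal (dist x y) \<le> d)"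
  by (simp add: ediam_def SUP_le_iff)

lemma dist_le_ediam: "x \<in> S \<Longrightarrow> y \<in> S \<Longrightarrow> ennreal (dist x y) \<le> ediam S"
  using ediam_le_iff[of S "ediam S"] by auto

lemma ediam_empty [simp]: "ediam {} = 0"
  by (simp add: ediam_def bot_ennreal)

lemma ediam_singleton [simp]: "ediam {x} = 0"
  by (simp add: ediam_def)

lemma ennreal_powr_mono:
  assumes "s \<le> t" "0 \<le> a"
  shows "ennreal_powr s a \<le> ennreal_powr t a"
proof (cases "t = \<infinity>")
  case False
  then have "enn2real s \<le> enn2real t" "s \<noteq> \<infinity>"
    using assms by (auto simp: enn2real_mono less_top[symmetric] top_unique)
  with False assms show ?thesis
    by (auto simp: ennreal_powr_def intro!: ennreal_leI powr_mono2)
qed (simp add: ennreal_powr_def)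

lemma zeta_ennreal:
  assumes "ediam S = ennreal D" "0 \<le> D" "0 \<le> c"
  shows "zeta c \<alpha> S = ennreal (c * D powr \<alpha>)"
  using assms by (simp add: zeta_def ennreal_powr_def ennreal_mult)

lemma zeta_le:
  assumes "ediam S \<le> ennreal D" "0 \<le> D" "0 \<le> c" "0 \<le> \<alpha>"
  shows "zeta c \<alpha> S \<le> ennreal (c * D powr \<alpha>)"
proof -
  have "ennreal_powr (ediam S) \<alpha> \<le> ennreal_powr (ennreal D) \<alpha>"
    using assms by (intro ennreal_powr_mono)
  then show ?thesis
    using assms by (simp add: zeta_def ennreal_powr_def ennreal_mult mult_left_mono)
qed

lemma zeta_empty [simp]: "zeta c \<alpha> {} = 0"
  by (simp add: zeta_def ennreal_powr_def)

lemma zeta_singleton [simp]: "zeta c \<alpha> {x} = 0"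
  by (simp add: zeta_def ennreal_powr_def)

subsection \<open>Hausdorff measure is a metric outer measure\<close>

lemma zeta_approx_le:
  assumes "\<And>j. closed (E j)" "\<And>j. ediam (E j) \<le> ennreal \<delta>" "R \<subseteq> (\<Union>j. E j)"
  shows "zeta_approx c \<alpha> \<delta> R \<le> (\<Sum>j. zeta c \<alpha> (E j))"
  unfolding zeta_approx_def using assms by (intro INF_lower) auto

lemma zeta_approx_mono: "R \<subseteq> R' \<Longrightarrow> zeta_approx c \<alpha> \<delta> R \<le> zeta_approx c \<alpha> \<delta> R'"
  unfolding zeta_approx_def by (intro INF_superset_mono) auto

lemma zeta_approx_antimono:
  assumes "\<delta> \<le> \<delta>'"
  shows "zeta_approx c \<alpha> \<delta>' R \<le> zeta_approx c \<alpha> \<delta> R"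
  unfolding zeta_approx_def
  using order_trans[OF _ ennreal_leI[OF assms]] by (intro INF_superset_mono) auto

lemma zeta_approx_less_iff:
  "zeta_approx c \<alpha> \<delta> R < e \<longleftrightarrow>
    (\<exists>E. (\<forall>j. closed (E j) \<and> ediam (E j) \<le> ennreal \<delta>) \<and> R \<subseteq> (\<Union>j. E j) \<and> (\<Sum>j. zeta c \<alpha> (E j)) < e)"
  unfolding zeta_approx_def INF_less_iff by (simp add: conj_assoc)

lemma zeta_approx_UN:
  fixes R :: "nat \<Rightarrow> 'a::metric_space set"
  shows "zeta_approx c \<alpha> \<delta> (\<Union>i. R i) \<le> (\<Sum>i. zeta_approx c \<alpha> \<delta> (R i))"
proof (rule ennreal_le_epsilon)
  fix e :: real
  assume e: "0 < e" and fin: "(\<Sum>i. zeta_approx c \<alpha> \<delta> (R i)) < top"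
  \<comment> \<open>Finiteness of the sum makes each term finite; only then is adding a positive
    number a strict increase, so that a covering below the new bound exists.\<close>
  have "zeta_approx c \<alpha> \<delta> (R i) < zeta_approx c \<alpha> \<delta> (R i) + e * (1/2)^Suc i" for i
    using e less_top ennreal_suminf_lessD[OF fin, of i]
    by (auto simp: ennreal_zero_less_mult_iff)
  then have "\<exists>E. (\<forall>j. closed (E j) \<and> ediam (E j) \<le> ennreal \<delta>) \<and> R i \<subseteq> (\<Union>j. E j)
      \<and> (\<Sum>j. zeta c \<alpha> (E j)) < zeta_approx c \<alpha> \<delta> (R i) + e * (1/2)^Suc i" for i
    by (simp only: zeta_approx_less_iff)
  then obtain E where E: "\<And>i j. closed (E i j)" "\<And>i j. ediam (E i j) \<le> ennreal \<delta>"
    "\<And>i. R i \<subseteq> (\<Union>j. E i j)"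
    "\<And>i. (\<Sum>j. zeta c \<alpha> (E i j)) < zeta_approx c \<alpha> \<delta> (R i) + e * (1/2)^Suc i"
    by metis
  define C where "C = (\<lambda>k. case_prod E (prod_decode k))"
  have "(\<Union>i. R i) \<subseteq> (\<Union>k. C k)"
  proof
    fix x assume "x \<in> (\<Union>i. R i)"
    then obtain i j where "x \<in> E i j"
      using E(3) by blast
    then have "x \<in> C (prod_encode (i, j))"
      by (simp add: C_def)
    then show "x \<in> (\<Union>k. C k)" by blast
  qed
  then have "zeta_approx c \<alpha> \<delta> (\<Union>i. R i) \<le> (\<Sum>k. zeta c \<alpha> (C k))"
    by (intro zeta_approx_le) (auto simp: C_def E split: prod.split)
  also have "\<dots> = (\<Sum>k. (zeta c \<alpha> \<circ> case_prod E) (prod_decode k))"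
    by (simp add: C_def)
  also have "\<dots> = (\<Sum>i. \<Sum>j. zeta c \<alpha> (E i j))"
    by (intro suminf_ennreal_2dimen) auto
  also have "\<dots> \<le> (\<Sum>i. zeta_approx c \<alpha> \<delta> (R i) + e * (1/2)^Suc i)"
    using E(4) by (intro suminf_le) (auto intro: less_imp_le)
  also have "\<dots> = (\<Sum>i. zeta_approx c \<alpha> \<delta> (R i)) + (\<Sum>i. ennreal e * ennreal ((1/2)^Suc i))"
    using e by (subst suminf_add[symmetric])
       (auto simp del: ennreal_suminf_cmult simp add: ennreal_mult[symmetric])
  also have "\<dots> = (\<Sum>i. zeta_approx c \<alpha> \<delta> (R i)) + e"
    unfolding ennreal_suminf_cmult
    by (subst suminf_ennreal_eq[OF zero_le_power power_half_series]) auto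
  finally show "zeta_approx c \<alpha> \<delta> (\<Union>i. R i) \<le> (\<Sum>i. zeta_approx c \<alpha> \<delta> (R i)) + e" .
qed

lemma zeta_approx_le_hausdorff: "0 < \<delta> \<Longrightarrow> zeta_approx c \<alpha> \<delta> R \<le> hausdorff c \<alpha> R"
  unfolding hausdorff_def by (intro SUP_upper) auto

lemma hausdorff_leI:
  assumes "\<And>\<delta>. 0 < \<delta> \<Longrightarrow> zeta_approx c \<alpha> \<delta> R \<le> h"
  shows "hausdorff c \<alpha> R \<le> h"
  unfolding hausdorff_def using assms by (intro SUP_least) auto

text \<open>A point covers itself at gauge 0, repeated at every index, since
  \<open>0 powr \<alpha>\<close> is 0. Together with absolute continuity this excludes atoms of
  \<open>\<mu>\<close> in \<open>A\<close>.\<close>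

lemma hausdorff_singleton [simp]: "hausdorff c \<alpha> {x} = 0"
proof -
  have "zeta_approx c \<alpha> \<delta> {x} \<le> (\<Sum>j::nat. zeta c \<alpha> {x})" for \<delta>
    by (intro zeta_approx_le) auto
  then have "hausdorff c \<alpha> {x} \<le> 0"
    by (intro hausdorff_leI) simp
  then show ?thesis by simp
qed

lemma hausdorff_mono: "R \<subseteq> R' \<Longrightarrow> hausdorff c \<alpha> R \<le> hausdorff c \<alpha> R'"
  by (meson hausdorff_leI order_trans zeta_approx_mono zeta_approx_le_hausdorff)

lemma hausdorff_UN: "hausdorff c \<alpha> (\<Union>i::nat. R i) \<le> (\<Sum>i. hausdorff c \<alpha> (R i))"
proof (rule hausdorff_leI)
  fix \<delta> :: real assume "0 < \<delta>"
  then show "zeta_approx c \<alpha> \<delta> (\<Union>i. R i) \<le> (\<Sum>i. hausdorff c \<alpha> (R i))"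
    by (intro order_trans[OF zeta_approx_UN] suminf_le zeta_approx_le_hausdorff) auto
qed

lemma outer_measure_space_hausdorff: "outer_measure_space UNIV (hausdorff c \<alpha>)"
proof -
  have "hausdorff c \<alpha> ({} :: 'a set) \<le> hausdorff c \<alpha> {undefined :: 'a}"
    by (rule hausdorff_mono) simp
  then show ?thesis
    unfolding outer_measure_space_def positive_def increasing_def countably_subadditive_def
    by (auto intro: hausdorff_mono hausdorff_UN)
qed

text \<open>A covering set of diameter at most \<open>\<delta> < d\<close> cannot meet both
  \<open>P\<close> and \<open>Q\<close>. Every covering of the union thus splits into a covering of
  \<open>P\<close> and one of \<open>Q\<close>; the removed members are replaced by the empty set,
  which is closed and has gauge 0, so the index set stays the same.\<close>

lemma zeta_approx_separated:
  fixes P Q :: "'a::metric_space set"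
  assumes sep: "\<And>x y. x \<in> P \<Longrightarrow> y \<in> Q \<Longrightarrow> d \<le> dist x y" and d: "\<delta> < d" "0 < d"
  shows "zeta_approx c \<alpha> \<delta> P + zeta_approx c \<alpha> \<delta> Q \<le> zeta_approx c \<alpha> \<delta> (P \<union> Q)"
  unfolding zeta_approx_def[of c \<alpha> \<delta> "P \<union> Q"]
proof (intro INF_greatest, clarify)
  fix E :: "nat \<Rightarrow> 'a set"
  assume E: "\<forall>j. closed (E j) \<and> ediam (E j) \<le> ennreal \<delta>" and sub: "P \<union> Q \<subseteq> (\<Union>j. E j)"
  define EP EQ where "EP j = (if E j \<inter> P = {} then {} else E j)"
    and "EQ j = (if E j \<inter> P = {} then E j else {})" for j
  have "P \<subseteq> (\<Union>j. EP j)"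
    using sub by (fastforce simp: EP_def)
  then have 1: "zeta_approx c \<alpha> \<delta> P \<le> (\<Sum>j. zeta c \<alpha> (EP j))"
    using E by (intro zeta_approx_le) (auto simp: EP_def)
  have "Q \<subseteq> (\<Union>j. EQ j)"
  proof
    fix y assume y: "y \<in> Q"
    then obtain j where j: "y \<in> E j" using sub by blast
    have "E j \<inter> P = {}"
    proof (rule ccontr)
      assume "E j \<inter> P \<noteq> {}"
      then obtain x where x: "x \<in> E j" "x \<in> P" by blast
      have "ennreal d \<le> ennreal (dist x y)"
        using sep x y by (intro ennreal_leI)
      also have "\<dots> \<le> ennreal \<delta>"
        using dist_le_ediam[OF x(1) j] E by (meson order_trans)
      finally show False
        using d by (auto simp: ennreal_le_iff2)
    qed
    with j show "y \<in> (\<Union>j. EQ j)" by (auto simp: EQ_def)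
  qed
  then have 2: "zeta_approx c \<alpha> \<delta> Q \<le> (\<Sum>j. zeta c \<alpha> (EQ j))"
    using E by (intro zeta_approx_le) (auto simp: EQ_def)
  have "(\<Sum>j. zeta c \<alpha> (E j)) = (\<Sum>j. zeta c \<alpha> (EP j) + zeta c \<alpha> (EQ j))"
    by (intro suminf_cong) (auto simp: EP_def EQ_def)
  also have "\<dots> = (\<Sum>j. zeta c \<alpha> (EP j)) + (\<Sum>j. zeta c \<alpha> (EQ j))"
    by (intro suminf_add[symmetric]) auto
  finally show "zeta_approx c \<alpha> \<delta> P + zeta_approx c \<alpha> \<delta> Q \<le> (\<Sum>j. zeta c \<alpha> (E j))"
    using add_mono[OF 1 2] by simp
qed

text \<open>The two suprema on the left run over independent scales \<open>\<delta>\<close> and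
  \<open>\<epsilon>\<close>. Shrinking both to a common scale below \<open>d\<close> only increases
  the summands and brings them where a covering splits.\<close>

lemma hausdorff_separated:
  fixes P Q :: "'a::metric_space set"
  assumes sep: "\<And>x y. x \<in> P \<Longrightarrow> y \<in> Q \<Longrightarrow> d \<le> dist x y" and d: "0 < d"
  shows "hausdorff c \<alpha> P + hausdorff c \<alpha> Q \<le> hausdorff c \<alpha> (P \<union> Q)"
proof -
  have *: "zeta_approx c \<alpha> \<delta> P + zeta_approx c \<alpha> \<epsilon> Q \<le> hausdorff c \<alpha> (P \<union> Q)"
    if "0 < \<delta>" "0 < \<epsilon>" for \<delta> \<epsilon>
  proof -
    define \<eta> where "\<eta> = min (min \<delta> \<epsilon>) (d/2)"
    have \<eta>: "0 < \<eta>" "\<eta> \<le> \<delta>" "\<eta> \<le> \<epsilon>" "\<eta> < d"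
      using that d by (auto simp: \<eta>_def min_def)
    have "zeta_approx c \<alpha> \<delta> P + zeta_approx c \<alpha> \<epsilon> Q \<le> zeta_approx c \<alpha> \<eta> P + zeta_approx c \<alpha> \<eta> Q"
      using \<eta> by (intro add_mono zeta_approx_antimono)
    also have "\<dots> \<le> zeta_approx c \<alpha> \<eta> (P \<union> Q)"
      using sep \<eta>(4) d by (rule zeta_approx_separated)
    also have "\<dots> \<le> hausdorff c \<alpha> (P \<union> Q)"
      using \<eta> by (intro zeta_approx_le_hausdorff)
    finally show ?thesis .
  qed
  have ne: "{0::real<..} \<noteq> {}" by simp
  have "hausdorff c \<alpha> P + hausdorff c \<alpha> Q
      = (SUP \<delta>\<in>{0<..}. zeta_approx c \<alpha> \<delta> P + hausdorff c \<alpha> Q)"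
    unfolding hausdorff_def[of c \<alpha> P] by (rule ennreal_SUP_add_left[OF ne, symmetric])
  also have "\<dots> \<le> hausdorff c \<alpha> (P \<union> Q)"
  proof (rule SUP_least)
    fix \<delta> :: real assume "\<delta> \<in> {0<..}"
    moreover have "zeta_approx c \<alpha> \<delta> P + hausdorff c \<alpha> Q
        = (SUP \<epsilon>\<in>{0<..}. zeta_approx c \<alpha> \<delta> P + zeta_approx c \<alpha> \<epsilon> Q)"
      unfolding hausdorff_def[of c \<alpha> Q] by (rule ennreal_SUP_add_right[OF ne])
    ultimately show "zeta_approx c \<alpha> \<delta> P + hausdorff c \<alpha> Q \<le> hausdorff c \<alpha> (P \<union> Q)"
      by (auto intro!: SUP_least *)
  qed
  finally show ?thesis .
qed

subsection \<open>Caratheodory's criterion\<close>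

lemma ennreal_suminf_tail:
  fixes f :: "nat \<Rightarrow> ennreal"
  assumes "(\<Sum>i. f i) \<noteq> top"
  shows "(\<lambda>n. \<Sum>i. f (i + n)) \<longlonglongrightarrow> 0"
proof -
  have "(\<lambda>n. sum f {..<n}) \<longlonglongrightarrow> (\<Sum>i. f i)"
    by (rule summable_LIMSEQ) simp
  then have "(\<lambda>n. (\<Sum>i. f i) - sum f {..<n}) \<longlonglongrightarrow> (\<Sum>i. f i) - (\<Sum>i. f i)"
    using assms by (intro tendsto_diff_ennreal) auto
  moreover have "(\<Sum>i. f i) - sum f {..<n} = (\<Sum>i. f (i + n))" for n
  proof -
    have "(\<Sum>i. f i) = sum f {..<n} + (\<Sum>i. f (i + n))"
      using suminf_offset[of f n] by (simp add: add.commute)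
    moreover have "sum f {..<n} \<noteq> top"
      using assms calculation by auto
    ultimately show ?thesis by (simp add: ennreal_add_diff_cancel_left)
  qed
  ultimately show ?thesis using assms by simp
qed

lemma outer_measure_mono: "outer_measure_space UNIV \<phi> \<Longrightarrow> R \<subseteq> S \<Longrightarrow> \<phi> R \<le> \<phi> S"
  by (auto simp: outer_measure_space_def increasing_def)

lemma outer_measure_space_empty: "outer_measure_space UNIV \<phi> \<Longrightarrow> \<phi> {} = 0"
  by (auto simp: outer_measure_space_def positive_def)

lemma outer_measure_UN:
  assumes "outer_measure_space UNIV \<phi>"
  shows "\<phi> (\<Union>i::nat. R i) \<le> (\<Sum>i. \<phi> (R i))"
proof -
  have "\<phi> (\<Union>i. R i) = \<phi> (\<Union>i. disjointed R i)"
    by (simp add: UN_disjointed_eq)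
  also have "\<dots> \<le> (\<Sum>i. \<phi> (disjointed R i))"
    using assms disjoint_family_disjointed[of R]
    by (simp add: outer_measure_space_def countably_subadditive_def)
  also have "\<dots> \<le> (\<Sum>i. \<phi> (R i))"
    by (intro suminf_le outer_measure_mono[OF assms] disjointed_subset) auto
  finally show ?thesis .
qed

lemma outer_measure_Un:
  assumes "outer_measure_space UNIV \<phi>"
  shows "\<phi> (R \<union> S) \<le> \<phi> R + \<phi> S"
proof -
  have "\<phi> (R \<union> S) = \<phi> (\<Union>i. binaryset R S i)"
    by (simp add: UN_binaryset_eq)
  also have "\<dots> \<le> (\<Sum>i. \<phi> (binaryset R S i))"
    by (rule outer_measure_UN[OF assms])
  also have "\<dots> = \<phi> R + \<phi> S"
    by (rule suminf_binaryset_eq) (rule outer_measure_space_empty[OF assms])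
  finally show ?thesis .
qed

lemma caratheodory_setsI:
  assumes "outer_measure_space UNIV \<phi>"
    and "\<And>T. \<phi> T < \<infinity> \<Longrightarrow> \<phi> (T \<inter> F) + \<phi> (T - F) \<le> \<phi> T"
  shows "F \<in> caratheodory_sets \<phi>"
proof -
  have "\<phi> (F \<inter> T) + \<phi> ((UNIV - F) \<inter> T) = \<phi> T" for T
  proof (rule antisym)
    have eq: "F \<inter> T = T \<inter> F" "(UNIV - F) \<inter> T = T - F" by auto
    show "\<phi> (F \<inter> T) + \<phi> ((UNIV - F) \<inter> T) \<le> \<phi> T"
      using assms(2)[of T] unfolding eq by (cases "\<phi> T = \<infinity>") (auto simp: less_top)
    have "T = (F \<inter> T) \<union> ((UNIV - F) \<inter> T)" by auto
    then show "\<phi> T \<le> \<phi> (F \<inter> T) + \<phi> ((UNIV - F) \<inter> T)"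
      using outer_measure_Un[OF assms(1)] by metis
  qed
  then show ?thesis by (simp add: caratheodory_sets_def lambda_system_def)
qed

lemma dist_ge_infdist_diff:
  "a \<le> infdist x F \<Longrightarrow> infdist y F \<le> b \<Longrightarrow> a - b \<le> dist x y"
  using infdist_triangle[of x F y] by simp

text \<open>The part of \<open>T\<close> near \<open>F\<close> but outside it is cut into shells by
  the distance to \<open>F\<close>. Shells of equal parity are separated by the shell between them,
  so their values add up to at most \<open>\<phi> T\<close>, and the series over all shells
  converges. Up to its tail, \<open>T - F\<close> is therefore a set at positive distance from
  \<open>F\<close>, where additivity is the assumption \<open>sep\<close>.\<close>

lemma caratheodory_criterion:
  fixes \<phi> :: "'a::metric_space set \<Rightarrow> ennreal"
  assumes om: "outer_measure_space UNIV \<phi>"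
    and sep: "\<And>P Q d. 0 < d \<Longrightarrow> (\<And>x y. x \<in> P \<Longrightarrow> y \<in> Q \<Longrightarrow> d \<le> dist x y) \<Longrightarrow> \<phi> P + \<phi> Q \<le> \<phi> (P \<union> Q)"
    and F: "closed F"
  shows "F \<in> caratheodory_sets \<phi>"
proof (cases "F = {}")
  \<comment> \<open>The convention \<open>infdist x {} = 0\<close> would break the argument below,
    in which points outside \<open>F\<close> must have positive distance to
    \<open>F\<close>.\<close>
  case True
  then show ?thesis
    by (intro caratheodory_setsI[OF om]) (simp add: outer_measure_space_empty[OF om])
next
  case ne: False
  note mono = outer_measure_mono[OF om]
  show ?thesis
  proof (rule caratheodory_setsI[OF om])
    fix T assume fin: "\<phi> T < \<infinity>"
    define r where "r k = 1 / real (Suc k)" for k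
    have r: "r (Suc k) < r k" for k by (simp add: r_def field_simps)
    then have dec: "decseq r" by (intro decseq_SucI less_imp_le)
    define R where "R k = {x\<in>T. r (Suc k) \<le> infdist x F \<and> infdist x F < r k}" for k
    have shells: "(\<Sum>k<n. \<phi> (R (2*k+j))) \<le> \<phi> (\<Union>k<n. R (2*k+j))" for n j
    proof (induction n)
      case (Suc n)
      show ?case
      proof (cases "n = 0")
        case False
        \<comment> \<open>The earlier shells of this parity have index at most
          \<open>2*n+j-2\<close>, so their points have distance at least \<open>r (2*n+j-1)\<close>
          to \<open>F\<close>, while on the new shell the distance is below
          \<open>r (2*n+j)\<close>. The gap between these radii is the width of the skipped
          shell.\<close>
        define a where "a = r (2*n+j-1)"
        have "\<phi> (\<Union>k<n. R (2*k+j)) + \<phi> (R (2*n+j)) \<le> \<phi> ((\<Union>k<n. R (2*k+j)) \<union> R (2*n+j))"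
        proof (rule sep)
          show "0 < a - r (2*n+j)"
            using r[of "2*n+j-1"] False by (simp add: a_def)
          fix x y assume x: "x \<in> (\<Union>k<n. R (2*k+j))" and y: "y \<in> R (2*n+j)"
          from x obtain k where k: "k < n" "x \<in> R (2*k+j)" by blast
          then have "a \<le> r (Suc (2*k+j))"
            unfolding a_def by (intro decseqD[OF dec]) linarith
          with k y show "a - r (2*n+j) \<le> dist x y"
            by (intro dist_ge_infdist_diff[where F=F]) (auto simp: R_def)
        qed
        also have "(\<Union>k<n. R (2*k+j)) \<union> R (2*n+j) = (\<Union>k<Suc n. R (2*k+j))"
          by (auto simp: lessThan_Suc)
        finally show ?thesis
          using order_trans[OF add_right_mono[OF Suc.IH]] by simp
      qed (simp add: lessThan_Suc)
    qed simp
    have half: "(\<Sum>k. \<phi> (R (2*k+j))) \<le> \<phi> T" for j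
    proof (rule suminf_le_const)
      fix n
      have "(\<Union>k<n. R (2*k+j)) \<subseteq> T" by (auto simp: R_def)
      then show "(\<Sum>k<n. \<phi> (R (2*k+j))) \<le> \<phi> T"
        using shells mono order_trans by blast
    qed simp
    have "(\<Sum>k. \<phi> (R k)) \<noteq> top"
    proof -
      have "(\<Sum>k<n. \<phi> (R k)) \<le> \<phi> T + \<phi> T" for n
      proof -
        have "(\<Sum>k<n. \<phi> (R k)) \<le> (\<Sum>k<2*n. \<phi> (R k))"
          by (intro sum_mono2) auto
        also have "\<dots> = (\<Sum>k<n. \<phi> (R (2*k+0))) + (\<Sum>k<n. \<phi> (R (2*k+1)))"
          by (induction n) (simp_all add: add_ac)
        also have "\<dots> \<le> (\<Sum>k. \<phi> (R (2*k+0))) + (\<Sum>k. \<phi> (R (2*k+1)))"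
          by (intro add_mono sum_le_suminf) auto
        also have "\<dots> \<le> \<phi> T + \<phi> T"
          by (intro add_mono half)
        finally show ?thesis .
      qed
      then have "(\<Sum>k. \<phi> (R k)) \<le> \<phi> T + \<phi> T"
        by (intro suminf_le_const) auto
      with fin show ?thesis by (auto simp: top_unique)
    qed
    then have tail: "(\<lambda>n. \<Sum>k. \<phi> (R (k + n))) \<longlonglongrightarrow> 0"
      by (rule ennreal_suminf_tail)
    have "\<phi> (T \<inter> F) + \<phi> (T - F) \<le> \<phi> T + (\<Sum>k. \<phi> (R (k + n)))" for n
    proof -
      define Tn where "Tn = {x\<in>T. r n \<le> infdist x F}"
      have "T - F \<subseteq> Tn \<union> (\<Union>k. R (k + n))"
      proof
        fix x assume x: "x \<in> T - F"
        then have pos: "0 < infdist x F"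
          using in_closed_iff_infdist_zero[OF F ne] infdist_nonneg[of x F] by (auto simp: less_le)
        show "x \<in> Tn \<union> (\<Union>k. R (k + n))"
        proof (cases "r n \<le> infdist x F")
          case False
          \<comment> \<open>The point lies in the shell with index \<open>m - 1\<close>; as its
            distance is below \<open>r n\<close>, this index is at least \<open>n\<close>, so the
            shell belongs to the tail.\<close>
          define m where "m = (LEAST m. r m \<le> infdist x F)"
          obtain m0 where "r m0 < infdist x F"
            using pos reals_Archimedean[of "infdist x F"] by (auto simp: r_def inverse_eq_divide)
          then have m: "r m \<le> infdist x F"
            unfolding m_def by (intro LeastI) (rule less_imp_le)
          then have "n < m"
            using False decseqD[OF dec, of m n] by (meson not_le_imp_less order_trans)
          then obtain k where k: "m = Suc (k + n)"
            using less_iff_Suc_add[of n m] by (auto simp: add.commute)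
          have "\<not> r (k + n) \<le> infdist x F"
            using not_less_Least[of "k+n" "\<lambda>m. r m \<le> infdist x F"] k by (simp add: m_def[symmetric])
          with m k x have "x \<in> R (k + n)" by (auto simp: R_def)
          then show ?thesis by blast
        qed (use x in \<open>auto simp: Tn_def\<close>)
      qed
      then have "\<phi> (T - F) \<le> \<phi> (Tn \<union> (\<Union>k. R (k + n)))"
        by (rule mono)
      also have "\<dots> \<le> \<phi> Tn + (\<Sum>k. \<phi> (R (k + n)))"
        by (intro order_trans[OF outer_measure_Un[OF om]] add_left_mono outer_measure_UN[OF om])
      finally have "\<phi> (T \<inter> F) + \<phi> (T - F) \<le> (\<phi> Tn + \<phi> (T \<inter> F)) + (\<Sum>k. \<phi> (R (k + n)))"
        by (simp add: add_left_mono add_ac)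
      also have "\<phi> Tn + \<phi> (T \<inter> F) \<le> \<phi> (Tn \<union> (T \<inter> F))"
      proof (rule sep)
        show "0 < r n - 0" by (simp add: r_def)
        show "r n - 0 \<le> dist x y" if "x \<in> Tn" "y \<in> T \<inter> F" for x y
          using that by (intro dist_ge_infdist_diff[where F=F]) (auto simp: Tn_def)
      qed
      also have "\<phi> (Tn \<union> (T \<inter> F)) \<le> \<phi> T"
        by (intro mono) (auto simp: Tn_def)
      finally show ?thesis by (simp add: add_right_mono)
    qed
    moreover have "(\<lambda>n. \<phi> T + (\<Sum>k. \<phi> (R (k + n)))) \<longlonglongrightarrow> \<phi> T + 0"
      by (intro tendsto_add tendsto_const tail)
    ultimately show "\<phi> (T \<inter> F) + \<phi> (T - F) \<le> \<phi> T"
      by (intro LIMSEQ_le_const[where X="\<lambda>n. \<phi> T + (\<Sum>k. \<phi> (R (k + n)))"]) auto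
  qed
qed

lemma sets_borel_subset_caratheodory:
  assumes "outer_measure_space UNIV \<phi>" and "\<And>U. open U \<Longrightarrow> U \<in> caratheodory_sets \<phi>"
  shows "sets borel \<subseteq> caratheodory_sets \<phi>"
proof -
  have "sigma_sets UNIV {S. open S} \<subseteq> sets (caratheodory_measure \<phi>)"
    using sets.sigma_sets_subset[of "{S. open S}" "caratheodory_measure \<phi>"] assms
    by (auto simp: sets_caratheodory_measure space_caratheodory_measure)
  then show ?thesis
    using assms by (simp add: sets_borel sets_caratheodory_measure)
qed

lemma sets_borel_subset_caratheodory_hausdorff:
  "sets borel \<subseteq> caratheodory_sets (hausdorff c \<alpha> :: 'a::metric_space set \<Rightarrow> ennreal)"
proof (rule sets_borel_subset_caratheodory[OF outer_measure_space_hausdorff])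
  fix U :: "'a set" assume "open U"
  then have "- U \<in> caratheodory_sets (hausdorff c \<alpha>)"
    by (intro caratheodory_criterion outer_measure_space_hausdorff hausdorff_separated) auto
  then have "- U \<in> sets (caratheodory_measure (hausdorff c \<alpha>))"
    by (simp add: sets_caratheodory_measure outer_measure_space_hausdorff)
  from sets.compl_sets[OF this] show "U \<in> caratheodory_sets (hausdorff c \<alpha>)"
    by (simp add: sets_caratheodory_measure outer_measure_space_hausdorff space_caratheodory_measure Compl_eq_Diff_UNIV[symmetric])
qed

subsection \<open>Measurability of the density\<close>

text \<open>An infinite union of closed balls need not be closed. The closure makes the thickened
  set a competitor in the gauge family and in coverings, without changing the diameter
  bound.\<close>

definition thicken :: "'a::metric_space set \<Rightarrow> real \<Rightarrow> 'a set" where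
  "thicken S r = closure (\<Union>x\<in>S. cball x r)"

lemma closed_thicken [simp]: "closed (thicken S r)"
  by (simp add: thicken_def)

lemma cball_subset_thicken: "x \<in> S \<Longrightarrow> cball x r \<subseteq> thicken S r"
  unfolding thicken_def by (rule order_trans[OF _ closure_subset]) auto

lemma subset_thicken: "0 \<le> r \<Longrightarrow> S \<subseteq> thicken S r"
  using cball_subset_thicken by fastforce

lemma ediam_thicken:
  assumes "ediam S \<le> ennreal D" "0 \<le> D" "0 \<le> r"
  shows "ediam (thicken S r) \<le> ennreal (D + 2 * r)"
proof -
  have near: "\<exists>x\<in>S. dist x u < r + e" if ue: "u \<in> thicken S r" "0 < e" for u e
  proof -
    obtain y x where "x \<in> S" "y \<in> cball x r" "dist y u < e"
      using ue unfolding thicken_def closure_approachable by blast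
    then show ?thesis
      using dist_triangle[of x u y] by (intro bexI[of _ x]) auto
  qed
  have "dist u v \<le> D + 2 * r" if uv: "u \<in> thicken S r" "v \<in> thicken S r" for u v
  proof (rule field_le_epsilon)
    fix e :: real assume "0 < e"
    then obtain x y where xy: "x \<in> S" "y \<in> S" "dist x u < r + e/2" "dist y v < r + e/2"
      using near[OF uv(1), of "e/2"] near[OF uv(2), of "e/2"] by auto
    then have "dist x y \<le> D"
      using dist_le_ediam[of x S y] assms by (metis ennreal_le_iff order_trans)
    moreover have "dist u v \<le> dist x u + dist x y + dist y v"
      using dist_triangle[of u v x] dist_triangle[of x v y] by (simp add: dist_commute)
    ultimately show "dist u v \<le> D + 2 * r + e"
      using xy by simp
  qed
  then show ?thesis
    by (auto simp: ediam_le_iff intro!: ennreal_leI)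
qed

lemma less_divide_ennreal: "b \<noteq> 0 \<Longrightarrow> b < top \<Longrightarrow> c < a / b \<longleftrightarrow> c * b < (a :: ennreal)"
  by (cases a; cases b; cases c)
     (auto simp: divide_ennreal ennreal_mult[symmetric] ennreal_less_iff field_simps ennreal_top_mult ennreal_top_divide)

text \<open>If the gauge is 0, membership in the family says exactly that \<open>\<mu> S\<close> is
  not 0, and the quotient is infinite by convention; both sides then reduce to
  \<open>0 < \<mu> S\<close> for closed \<open>S\<close>. If the gauge is positive and finite, the
  family excludes no closed set. The family and the quotient are thus eliminated together.\<close>

lemma gauge_quotient_greater_iff:
  assumes "\<zeta> S \<noteq> \<infinity>" "t \<noteq> \<infinity>"
  shows "S \<in> gauge_family \<mu> \<zeta> \<and> t < gauge_quotient \<mu> \<zeta> S \<longleftrightarrow> closed S \<and> t * \<zeta> S < \<mu> S"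
proof (cases "\<zeta> S = 0")
  case True
  then show ?thesis
    using assms by (auto simp: gauge_family_def gauge_quotient_def less_top zero_less_iff_neq_zero)
next
  case False
  then have "t < \<mu> S / \<zeta> S \<longleftrightarrow> t * \<zeta> S < \<mu> S"
    using assms by (intro less_divide_ennreal) (auto simp: less_top)
  then show ?thesis
    using assms False by (auto simp: gauge_family_def gauge_quotient_def)
qed

lemma zeta_finite: "ediam S \<noteq> \<infinity> \<Longrightarrow> zeta c \<alpha> S \<noteq> \<infinity>"
  by (simp add: zeta_def ennreal_powr_def ennreal_mult_eq_top_iff)

text \<open>The bound on the diameter makes the gauge finite, so the convention for infinite gauge
  never comes into play here.\<close>

lemma upper_quotient_greater_iff:
  assumes "t \<noteq> \<infinity>"
  shows "t < (SUP S\<in>{S \<in> gauge_family \<mu> (zeta c \<alpha>). x \<in> S \<and> ediam S < ennreal \<epsilon>}.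
      gauge_quotient \<mu> (zeta c \<alpha>) S) \<longleftrightarrow>
    (\<exists>S. closed S \<and> x \<in> S \<and> ediam S < ennreal \<epsilon> \<and> t * zeta c \<alpha> S < \<mu> S)"
proof -
  have "S \<in> gauge_family \<mu> (zeta c \<alpha>) \<and> t < gauge_quotient \<mu> (zeta c \<alpha>) S \<longleftrightarrow>
      closed S \<and> t * zeta c \<alpha> S < \<mu> S" if "ediam S < ennreal \<epsilon>" for S
    using that assms by (intro gauge_quotient_greater_iff zeta_finite) auto
  then show ?thesis
    unfolding less_SUP_iff by blast
qed

text \<open>A closed set of large quotient keeps it when slightly thickened, because \<^term>\<open>zeta c \<alpha>\<close> is
  continuous under thickening and \<^term>\<open>\<mu>\<close> is monotone.\<close>

lemma open_upper_quotient_greater: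
  fixes \<mu> :: "'a::metric_space set \<Rightarrow> ennreal"
  assumes "0 < \<alpha>" "0 \<le> c" and mono: "\<And>R S. R \<subseteq> S \<Longrightarrow> \<mu> R \<le> \<mu> S"
  shows "open {x. t < (SUP S\<in>{S \<in> gauge_family \<mu> (zeta c \<alpha>). x \<in> S \<and> ediam S < ennreal \<epsilon>}.
      gauge_quotient \<mu> (zeta c \<alpha>) S)}" (is "open ?G")
proof (cases "t = \<infinity>")
  case False
  then obtain s where s: "t = ennreal s" "0 \<le> s" by (cases t) auto
  note iff = upper_quotient_greater_iff[OF False, of \<mu> c \<alpha>]
  show ?thesis
    unfolding open_contains_ball
  proof
    fix x assume "x \<in> ?G"
    then obtain S where S: "closed S" "x \<in> S" "ediam S < ennreal \<epsilon>" "t * zeta c \<alpha> S < \<mu> S"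
      by (auto simp: iff)
    obtain D where D: "ediam S = ennreal D" "0 \<le> D"
      using S(3) by (cases "ediam S") auto
    have "D < \<epsilon>"
      using S(3) D by (simp add: ennreal_less_iff)
    have "((\<lambda>r. D + 2 * r) \<longlongrightarrow> D + 2 * 0) (at_right 0)"
      by (intro tendsto_intros)
    then have lim: "((\<lambda>r. D + 2 * r) \<longlongrightarrow> D) (at_right 0)" by simp
    have pos: "\<forall>\<^sub>F r in at_right 0. (0::real) < r"
      by (simp add: eventually_at_right_less)
    \<comment> \<open>For \<open>D = 0\<close> the base tends to 0, where continuity of
      \<open>powr\<close> rests on a positive exponent and an eventually nonnegative base; hence the
      one-sided limit.\<close>
    have "((\<lambda>r. ennreal (s * (c * (D + 2 * r) powr \<alpha>))) \<longlongrightarrow> ennreal (s * (c * D powr \<alpha>))) (at_right 0)"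
      using assms D pos by (intro tendsto_intros tendsto_powr' lim) (auto elim!: eventually_mono)
    moreover have "ennreal (s * (c * D powr \<alpha>)) < \<mu> S"
      using S(4) zeta_ennreal[OF D] assms s by (simp add: ennreal_mult)
    ultimately have "\<forall>\<^sub>F r in at_right 0. ennreal (s * (c * (D + 2 * r) powr \<alpha>)) < \<mu> S"
      by (rule order_tendstoD(2))
    with pos order_tendstoD(2)[OF lim \<open>D < \<epsilon>\<close>]
    have "\<forall>\<^sub>F r in at_right 0. 0 < r \<and> D + 2 * r < \<epsilon> \<and> ennreal (s * (c * (D + 2 * r) powr \<alpha>)) < \<mu> S"
      by eventually_elim auto
    then obtain r where r: "0 < r" "D + 2 * r < \<epsilon>" "ennreal (s * (c * (D + 2 * r) powr \<alpha>)) < \<mu> S"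
      using eventually_happens'[OF trivial_limit_at_right_real] by blast
    have diam: "ediam (thicken S r) \<le> ennreal (D + 2 * r)"
      using D r by (intro ediam_thicken) auto
    have "t * zeta c \<alpha> (thicken S r) \<le> t * ennreal (c * (D + 2 * r) powr \<alpha>)"
      using D r assms diam by (intro mult_left_mono zeta_le) auto
    also have "\<dots> < \<mu> S"
      using r(3) s assms by (simp add: ennreal_mult)
    also have "\<dots> \<le> \<mu> (thicken S r)"
      using r by (intro mono subset_thicken) auto
    finally have "t * zeta c \<alpha> (thicken S r) < \<mu> (thicken S r)" .
    moreover have "ediam (thicken S r) < ennreal \<epsilon>"
      using diam r D by (auto intro!: order_le_less_trans[OF diam] ennreal_lessI)
    moreover have "ball x r \<subseteq> thicken S r"
      using cball_subset_thicken[OF S(2), of r] by auto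
    ultimately have "ball x r \<subseteq> ?G"
      unfolding iff by (intro subsetI CollectI exI[of _ "thicken S r"]) auto
    with r show "\<exists>e>0. ball x e \<subseteq> ?G" by blast
  qed
qed simp

text \<open>At each fixed scale the supremum is lower semicontinuous, its strict superlevel sets
  being open. It is monotone in the scale, so the scales \<open>1 / Suc n\<close> suffice and the
  infimum becomes countable.\<close>

lemma borel_measurable_federer_density:
  fixes \<mu> :: "'a::metric_space set \<Rightarrow> ennreal"
  assumes "0 < \<alpha>" "0 \<le> c" and mono: "\<And>R S. R \<subseteq> S \<Longrightarrow> \<mu> R \<le> \<mu> S"
  shows "federer_density c \<alpha> \<mu> \<in> borel_measurable borel"
proof -
  define g where "g \<epsilon> x = (SUP S\<in>{S \<in> gauge_family \<mu> (zeta c \<alpha>). x \<in> S \<and> ediam S < ennreal \<epsilon>}.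
      gauge_quotient \<mu> (zeta c \<alpha>) S)" for \<epsilon> x
  have [measurable]: "g \<epsilon> \<in> borel_measurable borel" for \<epsilon>
    using open_upper_quotient_greater[of \<alpha> c \<mu>, OF assms]
    by (intro borel_measurableI_greater) (auto simp: g_def)
  have "federer_density c \<alpha> \<mu> x = (INF n::nat. g (1 / Suc n) x)" for x
    unfolding federer_density_def g_def[symmetric]
  proof (rule INF_eq)
    fix n :: nat assume "n \<in> UNIV"
    show "\<exists>\<epsilon>\<in>{0<..}. g \<epsilon> x \<le> g (1 / Suc n) x"
      by (intro bexI[of _ "1 / Suc n"]) auto
  next
    fix \<epsilon> :: real assume "\<epsilon> \<in> {0<..}"
    then obtain n where "1 / Suc n < \<epsilon>"
      using reals_Archimedean[of \<epsilon>] by (auto simp: inverse_eq_divide)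
    then have "ennreal (1 / Suc n) \<le> ennreal \<epsilon>"
      by (intro ennreal_leI) simp
    then show "\<exists>n\<in>UNIV. g (1 / Suc n) x \<le> g \<epsilon> x"
      unfolding g_def by (intro bexI[of _ n] SUP_subset_mono) auto
  qed
  then have "federer_density c \<alpha> \<mu> = (\<lambda>x. INF n::nat. g (1 / Suc n) x)" by (rule ext)
  then show ?thesis by simp
qed

subsection \<open>Restriction of outer measures to Borel sets, and outer regularity\<close>

text \<open>The Caratheodory sets of two outer measures may differ. Pushing forward along the
  identity puts both on the Borel sets, as Radon-Nikodym requires, and the density
  \<open>indicator A\<close> performs the restriction.\<close>

definition borel_restriction :: "('a::topological_space set \<Rightarrow> ennreal) \<Rightarrow> 'a set \<Rightarrow> 'a measure" where
  "borel_restriction \<phi> A = density (distr (caratheodory_measure \<phi>) borel (\<lambda>x. x)) (indicator A)"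

lemma sets_borel_restriction [simp, measurable_cong]: "sets (borel_restriction \<phi> A) = sets borel"
  by (simp add: borel_restriction_def)

lemma space_borel_restriction [simp]: "space (borel_restriction \<phi> A) = UNIV"
  by (simp add: borel_restriction_def)

lemma measurable_ident_caratheodory:
  assumes "outer_measure_space UNIV \<phi>" "sets borel \<subseteq> caratheodory_sets \<phi>"
  shows "(\<lambda>x. x) \<in> measurable (caratheodory_measure \<phi>) borel"
  using assms by (intro measurableI) (auto simp: space_caratheodory_measure sets_caratheodory_measure)

lemma emeasure_borel_restriction:
  assumes "outer_measure_space UNIV \<phi>" "sets borel \<subseteq> caratheodory_sets \<phi>" "A \<in> sets borel" "B \<in> sets borel"
  shows "emeasure (borel_restriction \<phi> A) B = \<phi> (A \<inter> B)"
proof -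
  have "A \<inter> B \<in> sets borel" using assms by auto
  then have "emeasure (distr (caratheodory_measure \<phi>) borel (\<lambda>x. x)) (A \<inter> B) = \<phi> (A \<inter> B)"
    using assms by (subst emeasure_distr[OF measurable_ident_caratheodory])
      (auto simp: space_caratheodory_measure emeasure_caratheodory_measure)
  then show ?thesis
    using assms by (simp add: borel_restriction_def emeasure_restricted)
qed

lemma nn_integral_borel_restriction:
  assumes "outer_measure_space UNIV \<phi>" "sets borel \<subseteq> caratheodory_sets \<phi>" "A \<in> sets borel" "f \<in> borel_measurable borel"
  shows "(\<integral>\<^sup>+x. f x \<partial>borel_restriction \<phi> A) = (\<integral>\<^sup>+x\<in>A. f x \<partial>caratheodory_measure \<phi>)"
  using assms
  by (simp add: borel_restriction_def nn_integral_density nn_integral_distr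
      measurable_ident_caratheodory mult.commute)

text \<open>The sets that can be squeezed in this way form a sigma-algebra containing the open sets.
  The two-sided form is what makes the induction work: under complements the closed and the open set
  exchange their roles.\<close>

lemma finite_borel_measure_regular:
  fixes M :: "'a::metric_space measure"
  assumes "finite_measure M" and sets: "sets M = sets borel" and "B \<in> sets borel" and "0 < e"
  shows "\<exists>C U. closed C \<and> open U \<and> C \<subseteq> B \<and> B \<subseteq> U \<and> emeasure M (U - C) < ennreal e"
proof -
  interpret finite_measure M by fact
  note [simp] = sets
  have *: "\<forall>e>0. \<exists>C U. closed C \<and> open U \<and> C \<subseteq> B \<and> B \<subseteq> U \<and> emeasure M (U - C) < ennreal e"
    if "B \<in> sigma_sets UNIV {S. open S}" for B
    using that
  proof induction
    case (Basic S)
    then have S: "open S" by simp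
    show ?case
    proof (intro allI impI)
      fix e :: real assume e: "0 < e"
      show "\<exists>C U. closed C \<and> open U \<and> C \<subseteq> S \<and> S \<subseteq> U \<and> emeasure M (U - C) < ennreal e"
      proof (cases "- S = {}")
        \<comment> \<open>As \<open>infdist\<close> to the empty set is 0 by convention, every
          \<open>C n\<close> below would be empty; here \<open>S\<close> is the whole space and is
          itself closed.\<close>
        case True
        then have "S = UNIV" by auto
        then show ?thesis
          using e by (intro exI[of _ UNIV]) auto
      next
        case False
        define C where "C n = {x. 1 / real (Suc n) \<le> infdist x (- S)}" for n
        have closed: "closed (C n)" for n
          unfolding C_def by (intro closed_Collect_le continuous_intros)
        have CS: "C n \<subseteq> S" for n
        proof
          fix x assume "x \<in> C n"
          then have "0 < infdist x (- S)"
            by (auto simp: C_def intro: less_le_trans[rotated])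
          then show "x \<in> S"
            using infdist_zero[of x "- S"] by (cases "x \<in> S") auto
        qed
        have UN: "(\<Inter>n. S - C n) = {}"
        proof safe
          fix x assume x: "x \<in> (\<Inter>n. S - C n)"
          then have "0 < infdist x (- S)"
            using in_closed_iff_infdist_zero[of "- S" x] False S infdist_nonneg[of x "- S"]
            by (auto simp: less_le)
          then obtain n where "1 / real (Suc n) < infdist x (- S)"
            using reals_Archimedean by (auto simp: inverse_eq_divide)
          then have "x \<in> C n" by (simp add: C_def)
          with x show "x \<in> {}" by blast
        qed
        have "decseq (\<lambda>n. S - C n)"
        proof (rule decseq_SucI)
          fix n
          have "1 / real (Suc (Suc n)) \<le> 1 / real (Suc n)" by (simp add: field_simps)
          then show "S - C (Suc n) \<subseteq> S - C n" by (auto simp: C_def)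
        qed
        then have "(\<lambda>n. emeasure M (S - C n)) \<longlonglongrightarrow> emeasure M (\<Inter>n. S - C n)"
          using S closed by (intro Lim_emeasure_decseq) auto
        then have "(\<lambda>n. emeasure M (S - C n)) \<longlonglongrightarrow> 0"
          unfolding UN by simp
        from order_tendstoD(2)[OF this, of "ennreal e"] e
        obtain n where "emeasure M (S - C n) < ennreal e"
          by (auto simp: eventually_sequentially)
        then show ?thesis
          using closed CS S by (intro exI[of _ "C n"] exI[of _ S]) auto
      qed
    qed
  next
    case Empty
    show ?case by (auto intro!: exI[of _ "{}"])
  next
    case (Compl B)
    show ?case
    proof (intro allI impI)
      fix e :: real assume "0 < e"
      obtain C U where CU: "closed C" "open U" "C \<subseteq> B" "B \<subseteq> U" "emeasure M (U - C) < ennreal e"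
        using Compl.IH[rule_format, OF \<open>0 < e\<close>] by (elim exE conjE)
      have "- C - (- U) = U - C" by auto
      then have "closed (- U) \<and> open (- C) \<and> - U \<subseteq> UNIV - B \<and> UNIV - B \<subseteq> - C \<and> emeasure M (- C - (- U)) < ennreal e"
        using CU by (auto simp: open_Compl closed_Compl)
      then show "\<exists>C U. closed C \<and> open U \<and> C \<subseteq> UNIV - B \<and> UNIV - B \<subseteq> U \<and> emeasure M (U - C) < ennreal e"
        by (intro exI)
    qed
  next
    case (Union B)
    show ?case
    proof (intro allI impI)
      fix e :: real assume e: "0 < e"
      have "\<exists>C U. closed C \<and> open U \<and> C \<subseteq> B i \<and> B i \<subseteq> U \<and>
          emeasure M (U - C) < ennreal (e/2 * (1/2)^Suc i)" for i
        using Union.IH[of i] e by auto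
      then obtain C U where CU: "\<And>i. closed (C i)" "\<And>i. open (U i)" "\<And>i. C i \<subseteq> B i" "\<And>i. B i \<subseteq> U i"
          "\<And>i. emeasure M (U i - C i) < ennreal (e/2 * (1/2)^Suc i)"
        by metis
      have meas [measurable]: "C i \<in> sets M" "U i \<in> sets M" for i
        using CU(1,2)[of i] by auto
      \<comment> \<open>An infinite union of closed sets need not be closed, so only finitely many
        \<open>C i\<close> are kept. Finiteness of the measure makes the discarded part smaller than
        \<open>e/2\<close>; the other half of \<open>e\<close> pays for the open sets.\<close>
      have "decseq (\<lambda>n. (\<Union>i. C i) - (\<Union>i<n. C i))"
        by (intro decseq_SucI) (auto simp: lessThan_Suc)
      then have "(\<lambda>n. emeasure M ((\<Union>i. C i) - (\<Union>i<n. C i))) \<longlonglongrightarrow> emeasure M (\<Inter>n. (\<Union>i. C i) - (\<Union>i<n. C i))"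
        using meas by (intro Lim_emeasure_decseq) auto
      moreover have eq: "(\<Inter>n. (\<Union>i. C i) - (\<Union>i<n. C i)) = {}" by auto
      ultimately have "(\<lambda>n. emeasure M ((\<Union>i. C i) - (\<Union>i<n. C i))) \<longlonglongrightarrow> 0"
        unfolding eq by simp
      from order_tendstoD(2)[OF this, of "ennreal (e/2)"] e
      obtain n where n: "emeasure M ((\<Union>i. C i) - (\<Union>i<n. C i)) < ennreal (e/2)"
        by (auto simp: eventually_sequentially)
      have "emeasure M ((\<Union>i. U i) - (\<Union>i. C i)) \<le> emeasure M (\<Union>i. U i - C i)"
        using meas by (intro emeasure_mono) auto
      also have "\<dots> \<le> (\<Sum>i. emeasure M (U i - C i))"
        using meas by (intro emeasure_subadditive_countably) auto
      also have "\<dots> \<le> (\<Sum>i. ennreal (e/2 * (1/2)^Suc i))"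
        using CU(5) by (intro suminf_le) (auto intro: less_imp_le)
      also have "\<dots> = ennreal (e/2)"
      proof (rule suminf_ennreal_eq)
        show "(\<lambda>i. e/2 * (1/2)^Suc i) sums (e/2)"
          using sums_mult[OF power_half_series, of "e/2"] unfolding mult_1_right .
      qed (use e in simp)
      finally have 2: "emeasure M ((\<Union>i. U i) - (\<Union>i. C i)) \<le> ennreal (e/2)" .
      have "emeasure M ((\<Union>i. U i) - (\<Union>i<n. C i))
          \<le> emeasure M (((\<Union>i. U i) - (\<Union>i. C i)) \<union> ((\<Union>i. C i) - (\<Union>i<n. C i)))"
        using meas by (intro emeasure_mono) auto
      also have "\<dots> \<le> emeasure M ((\<Union>i. U i) - (\<Union>i. C i)) + emeasure M ((\<Union>i. C i) - (\<Union>i<n. C i))"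
        using meas by (intro emeasure_subadditive) auto
      also have "\<dots> \<le> ennreal (e/2) + emeasure M ((\<Union>i. C i) - (\<Union>i<n. C i))"
        using 2 by (rule add_right_mono)
      also have "\<dots> < ennreal (e/2) + ennreal (e/2)"
        using n by (simp add: ennreal_add_left_cancel_less del: ennreal_half)
      also have "\<dots> = ennreal e"
        using e by (simp add: ennreal_plus[symmetric] del: ennreal_plus)
      finally have "emeasure M ((\<Union>i. U i) - (\<Union>i<n. C i)) < ennreal e" .
      moreover have "closed (\<Union>i<n. C i)" "open (\<Union>i. U i)"
        using CU by auto
      moreover have "(\<Union>i<n. C i) \<subseteq> (\<Union>i. B i)" "(\<Union>i. B i) \<subseteq> (\<Union>i. U i)"
        using CU(3,4) by (fast, fast)
      ultimately have "closed (\<Union>i<n. C i) \<and> open (\<Union>i. U i) \<and> (\<Union>i<n. C i) \<subseteq> (\<Union>i. B i) \<and>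
          (\<Union>i. B i) \<subseteq> (\<Union>i. U i) \<and> emeasure M ((\<Union>i. U i) - (\<Union>i<n. C i)) < ennreal e"
        by (intro conjI)
      then show "\<exists>C U. closed C \<and> open U \<and> C \<subseteq> (\<Union>i. B i) \<and> (\<Union>i. B i) \<subseteq> U \<and> emeasure M (U - C) < ennreal e"
        by (intro exI)
    qed
  qed
  from *[of B] assms show ?thesis by (simp add: sets_borel)
qed

subsection \<open>Comparison with Hausdorff measure\<close>

lemma measure_le_of_density_less:
  fixes \<mu> :: "'a::metric_space set \<Rightarrow> ennreal" and t :: real
  assumes "0 < \<alpha>" "0 \<le> c" "0 < t"
    and om: "outer_measure_space UNIV \<mu>" and car: "sets borel \<subseteq> caratheodory_sets \<mu>"
    and B: "B \<in> sets borel" and less: "\<And>x. x \<in> B \<Longrightarrow> federer_density c \<alpha> \<mu> x < ennreal t"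
  shows "\<mu> B \<le> ennreal t * hausdorff c \<alpha> B"
proof -
  define g where "g \<epsilon> x = (SUP S\<in>{S \<in> gauge_family \<mu> (zeta c \<alpha>). x \<in> S \<and> ediam S < ennreal \<epsilon>}.
      gauge_quotient \<mu> (zeta c \<alpha>) S)" for \<epsilon> x
  have g_mono: "g \<epsilon> x \<le> g \<epsilon>' x" if "\<epsilon> \<le> \<epsilon>'" for \<epsilon> \<epsilon>' x
    unfolding g_def using order_less_le_trans[OF _ ennreal_leI[OF that]]
    by (intro SUP_subset_mono) auto
  define Bn where "Bn n = {x\<in>B. g (1 / real (Suc n)) x \<le> ennreal t}" for n
  \<comment> \<open>Removing an open set from \<open>B\<close> leaves a Borel set, and measurability
    of \<open>Bn n\<close> allows \<open>\<mu>\<close> to pass to the increasing union at the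
    end.\<close>
  have "{x. ennreal t < g \<epsilon> x} \<in> sets borel" for \<epsilon>
    unfolding g_def using assms outer_measure_mono[OF om]
    by (intro borel_open open_upper_quotient_greater) auto
  then have "B - {x. ennreal t < g (1 / real (Suc n)) x} \<in> sets borel" for n
    using B by blast
  moreover have "Bn n = B - {x. ennreal t < g (1 / real (Suc n)) x}" for n
    by (auto simp: Bn_def)
  ultimately have Bn: "Bn n \<in> caratheodory_sets \<mu>" for n
    using car by auto
  have bound: "\<mu> (Bn n) \<le> ennreal t * hausdorff c \<alpha> B" for n
  proof -
    \<comment> \<open>Coverings allow diameter equal to \<open>\<delta>\<close>, whereas the density
      tests diameters strictly below the scale; hence the next smaller fraction.\<close>
    define \<delta> where "\<delta> = 1 / real (Suc (Suc n))"
    have \<delta>: "0 < \<delta>" "\<delta> < 1 / real (Suc n)" by (auto simp: \<delta>_def field_simps)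
    have "\<mu> (Bn n) / ennreal t \<le> zeta_approx c \<alpha> \<delta> (Bn n)"
      unfolding zeta_approx_def
    proof (intro INF_greatest, clarify)
      fix E :: "nat \<Rightarrow> 'a set"
      assume E: "\<forall>j. closed (E j) \<and> ediam (E j) \<le> ennreal \<delta>" and sub: "Bn n \<subseteq> (\<Union>j. E j)"
      \<comment> \<open>The bound for \<open>E j\<close> comes from a point of \<open>Bn n\<close>
        in it; a covering set containing no such point contributes nothing, which is why it is first
        cut with \<open>Bn n\<close>.\<close>
      have Ej: "\<mu> (E j \<inter> Bn n) \<le> ennreal t * zeta c \<alpha> (E j)" for j
      proof (cases "E j \<inter> Bn n = {}")
        case True
        then show ?thesis by (simp add: outer_measure_space_empty[OF om])
      next
        case False
        then obtain x where x: "x \<in> E j" "x \<in> Bn n" by blast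
        have "ediam (E j) < ennreal (1 / real (Suc n))"
          using E \<delta> by (intro order_le_less_trans[OF _ ennreal_lessI]) auto
        moreover have "\<not> ennreal t < g (1 / real (Suc n)) x"
          using x by (auto simp: Bn_def not_less)
        ultimately have "\<mu> (E j) \<le> ennreal t * zeta c \<alpha> (E j)"
          using x E unfolding g_def by (subst (asm) upper_quotient_greater_iff) (auto simp: not_less)
        then show ?thesis
          using outer_measure_mono[OF om, of "E j \<inter> Bn n" "E j"] by auto
      qed
      have "\<mu> (Bn n) = \<mu> (\<Union>j. E j \<inter> Bn n)"
        using sub by (intro arg_cong[where f=\<mu>]) auto
      also have "\<dots> \<le> (\<Sum>j. \<mu> (E j \<inter> Bn n))"
        by (rule outer_measure_UN[OF om])
      also have "\<dots> \<le> (\<Sum>j. ennreal t * zeta c \<alpha> (E j))"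
        by (intro suminf_le Ej) auto
      finally have "\<mu> (Bn n) \<le> ennreal t * (\<Sum>j. zeta c \<alpha> (E j))" by simp
      then show "\<mu> (Bn n) / ennreal t \<le> (\<Sum>j. zeta c \<alpha> (E j))"
        using \<open>0 < t\<close> by (intro divide_le_posI_ennreal) auto
    qed
    also have "\<dots> \<le> hausdorff c \<alpha> (Bn n)"
      by (rule zeta_approx_le_hausdorff) (rule \<delta>)
    also have "\<dots> \<le> hausdorff c \<alpha> B"
      by (rule hausdorff_mono) (auto simp: Bn_def)
    finally have "ennreal t * (\<mu> (Bn n) / ennreal t) \<le> ennreal t * hausdorff c \<alpha> B"
      by (rule mult_left_mono) simp
    moreover have "ennreal t * (\<mu> (Bn n) / ennreal t) = \<mu> (Bn n)"
      using \<open>0 < t\<close> by (simp add: ennreal_times_divide mult.commute[of "ennreal t"] mult_divide_eq_ennreal)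
    ultimately show ?thesis by simp
  qed
  have UN: "B = (\<Union>n. Bn n)"
  proof safe
    fix x assume x: "x \<in> B"
    from less[OF x] obtain \<epsilon> where \<epsilon>: "0 < \<epsilon>" "g \<epsilon> x < ennreal t"
      by (auto simp: federer_density_def INF_less_iff g_def)
    obtain n where "1 / real (Suc n) < \<epsilon>"
      using reals_Archimedean[OF \<epsilon>(1)] by (auto simp: inverse_eq_divide)
    then have "g (1 / real (Suc n)) x \<le> g \<epsilon> x" by (intro g_mono) simp
    with \<epsilon> x have "x \<in> Bn n" by (auto simp: Bn_def)
    then show "x \<in> (\<Union>n. Bn n)" by blast
  qed (auto simp: Bn_def)
  have inc: "incseq Bn"
  proof (rule incseq_SucI)
    fix n
    have "g (1 / real (Suc (Suc n))) x \<le> g (1 / real (Suc n)) x" for x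
      by (intro g_mono) (simp add: field_simps)
    then show "Bn n \<subseteq> Bn (Suc n)"
      unfolding Bn_def by (auto intro: order_trans)
  qed
  have "\<mu> B = emeasure (caratheodory_measure \<mu>) (\<Union>n. Bn n)"
    unfolding UN[symmetric] using B car by (intro emeasure_caratheodory_measure[OF om, symmetric]) auto
  also have "\<dots> = (SUP n. emeasure (caratheodory_measure \<mu>) (Bn n))"
    using Bn inc by (intro SUP_emeasure_incseq[symmetric]) (auto simp: sets_caratheodory_measure[OF om])
  also have "\<dots> = (SUP n. \<mu> (Bn n))"
    using Bn by (simp add: emeasure_caratheodory_measure[OF om])
  finally show ?thesis using bound by (auto intro: SUP_least)
qed

text \<open>Each choice takes, among the members of \<open>F\<close> still disjoint from all earlier
  choices, one whose diameter exceeds half the supremum \<open>s\<close>; the bound \<open>D\<close>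
  keeps \<open>s\<close> finite. When \<open>s\<close> is 0, in particular when no member is left,
  the empty set is chosen, so the sequence never stops.\<close>

lemma greedy_disjoint_sequence:
  fixes F :: "'a::metric_space set set" and D :: real
  assumes D: "\<forall>S\<in>F. ediam S \<le> ennreal D"
  shows "\<exists>f :: nat \<Rightarrow> 'a set. (\<forall>n. f n \<in> insert {} F) \<and> disjoint_family f \<and>
    (\<forall>n. \<forall>S\<in>F. S \<inter> (\<Union>i<n. f i) = {} \<longrightarrow> ediam S \<le> 2 * ediam (f n))"
proof -
  let ?P = "\<lambda>f (n::nat) T. T \<in> insert {} F \<and> T \<inter> (\<Union>i<n. f i) = {} \<and>
      (\<forall>S\<in>F. S \<inter> (\<Union>i<n. f i) = {} \<longrightarrow> ediam S \<le> 2 * ediam T)"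
  have "\<exists>f. \<forall>n. ?P f n (f n)"
  proof (rule dependent_wellorder_choice)
    fix r :: "'a set" and f g :: "nat \<Rightarrow> 'a set" and n
    assume "\<And>y. y < n \<Longrightarrow> f y = g y"
    then have "(\<Union>i<n. f i) = (\<Union>i<n. g i)" by auto
    then show "?P f n r = ?P g n r" by simp
  next
    fix n and f :: "nat \<Rightarrow> 'a set"
    define V where "V = {S\<in>F. S \<inter> (\<Union>i<n. f i) = {}}"
    define s where "s = (SUP S\<in>V. ediam S)"
    have s: "ediam S \<le> s" if "S \<in> V" for S
      unfolding s_def using that by (rule SUP_upper)
    show "\<exists>T. ?P f n T"
    proof (cases "s = 0")
      case True
      then show ?thesis
        using s by (intro exI[of _ "{}"]) (auto simp: V_def)
    next
      case False
      have "s \<le> ennreal D"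
        unfolding s_def by (intro SUP_least D[rule_format]) (auto simp: V_def)
      then obtain r where r: "s = ennreal r" "0 < r"
        using False by (cases s) (auto simp: top_unique less_le)
      then have "ennreal (r/2) < s"
        by (simp add: ennreal_lessI)
      then obtain T where T: "T \<in> V" "ennreal (r/2) < ediam T"
        unfolding s_def less_SUP_iff by blast
      have "s = 2 * ennreal (r/2)"
        using r by (simp add: ennreal_mult'[symmetric] flip: ennreal_numeral)
      also have "\<dots> \<le> 2 * ediam T"
        using T by (intro mult_left_mono less_imp_le) auto
      finally show ?thesis
        using T s by (intro exI[of _ T]) (auto simp: V_def intro: order_trans)
    qed
  qed
  then obtain f where f: "\<And>n. ?P f n (f n)" by blast
  have "f m \<inter> f n = {}" if "m < n" for m n
    using f[of n] that by auto
  then have "disjoint_family f"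
    unfolding disjoint_family_on_def by (metis Int_commute linorder_neqE_nat)
  with f show ?thesis by (intro exI[of _ f]) blast
qed

text \<open>A Vitali-type argument: the disjoint sets chosen greedily have total gauge at most \<^term>\<open>\<mu> U / t\<close>, and
  the sets from the \<open>N\<close>-th on, once enlarged five times, cover whatever the first \<open>N\<close> of them miss.\<close>

lemma hausdorff_le_of_density_greater_open:
  fixes \<mu> :: "'a::metric_space set \<Rightarrow> ennreal" and t :: real
  assumes \<alpha>: "0 < \<alpha>" and c: "0 < c" and t: "0 < t"
    and om: "outer_measure_space UNIV \<mu>" and car: "sets borel \<subseteq> caratheodory_sets \<mu>"
    and U: "open U" "\<mu> U < \<infinity>" and BU: "B \<subseteq> U"
    and greater: "\<And>x. x \<in> B \<Longrightarrow> ennreal t < federer_density c \<alpha> \<mu> x"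
    and no_atom: "\<And>x. x \<in> B \<Longrightarrow> \<mu> {x} = 0"
  shows "ennreal t * hausdorff c \<alpha> B \<le> \<mu> U"
proof -
  have "ennreal t * zeta_approx c \<alpha> \<delta> B \<le> \<mu> U" if \<delta>: "0 < \<delta>" for \<delta>
  proof -
    \<comment> \<open>Thickening a set of diameter \<open>d n\<close> by \<open>2 * d n\<close> adds
      twice that radius, giving \<open>5 * d n\<close>; the bound \<open>\<delta>/5\<close> keeps
      the enlarged sets admissible at scale \<open>\<delta>\<close>.\<close>
    define F where "F = {S. closed S \<and> S \<subseteq> U \<and> S \<inter> B \<noteq> {} \<and> ediam S \<le> ennreal (\<delta>/5) \<and>
        ennreal t * zeta c \<alpha> S < \<mu> S}"
    have fine: "\<exists>S\<in>F. x \<in> S \<and> S \<subseteq> V" if x: "x \<in> B" and V: "open V" "x \<in> V" for x V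
    proof -
      have "open (U \<inter> V)" "x \<in> U \<inter> V" using U V x BU by auto
      then obtain e where e: "0 < e" "ball x e \<subseteq> U \<inter> V"
        by (meson open_contains_ball)
      define \<epsilon> where "\<epsilon> = min e (\<delta>/5)"
      have \<epsilon>: "0 < \<epsilon>" "\<epsilon> \<le> e" "\<epsilon> \<le> \<delta>/5" using e \<delta> by (auto simp: \<epsilon>_def)
      have "ennreal t < (SUP S\<in>{S \<in> gauge_family \<mu> (zeta c \<alpha>). x \<in> S \<and> ediam S < ennreal \<epsilon>}.
          gauge_quotient \<mu> (zeta c \<alpha>) S)"
        using greater[OF x] unfolding federer_density_def
        by (rule order_less_le_trans) (use \<epsilon>(1) in \<open>auto intro: INF_lower\<close>)
      then obtain S where S: "closed S" "x \<in> S" "ediam S < ennreal \<epsilon>" "ennreal t * zeta c \<alpha> S < \<mu> S"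
        by (subst (asm) upper_quotient_greater_iff) auto
      have "S \<subseteq> ball x e"
      proof
        fix y assume "y \<in> S"
        then have "ennreal (dist x y) < ennreal \<epsilon>"
          using dist_le_ediam[OF S(2)] S(3) by (meson order_le_less_trans)
        then show "y \<in> ball x e" using \<epsilon> by (simp add: ennreal_less_iff)
      qed
      moreover have "ediam S \<le> ennreal (\<delta>/5)"
        using S(3) ennreal_leI[OF \<epsilon>(3)] by (meson less_imp_le order_trans)
      ultimately show ?thesis
        using S e x by (intro bexI[of _ S]) (auto simp: F_def)
    qed
    have Fdiam: "\<forall>S\<in>F. ediam S \<le> ennreal (\<delta>/5)"
      by (simp add: F_def)
    \<comment> \<open>A nonempty set of diameter 0 is a point of \<open>B\<close>, which has measure
      0 and so violates the strict inequality in \<open>F\<close>. Without this, a point could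
      escape all chosen sets although their diameters tend to 0.\<close>
    have pos: "ediam S \<noteq> 0" if "S \<in> F" for S
    proof
      assume 0: "ediam S = 0"
      obtain x where x: "x \<in> S" "x \<in> B"
        using \<open>S \<in> F\<close> unfolding F_def by blast
      have "y = x" if "y \<in> S" for y
      proof -
        have "ennreal (dist y x) \<le> 0"
          using dist_le_ediam[OF that x(1)] unfolding 0 .
        then show "y = x"
          by (simp add: ennreal_eq_0_iff)
      qed
      then have "S = {x}" using x(1) by blast
      then have "\<mu> S = 0" using no_atom[OF x(2)] by simp
      moreover have "ennreal t * zeta c \<alpha> S < \<mu> S"
        using \<open>S \<in> F\<close> unfolding F_def by blast
      ultimately show False by simp
    qed
    obtain f :: "nat \<Rightarrow> 'a set" where f: "\<forall>n. f n \<in> insert {} F" "disjoint_family f"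
        "\<forall>n. \<forall>S\<in>F. S \<inter> (\<Union>i<n. f i) = {} \<longrightarrow> ediam S \<le> 2 * ediam (f n)"
      using greedy_disjoint_sequence[OF Fdiam] by blast
    have closed: "closed (f n)" and fU: "f n \<subseteq> U" and diam: "ediam (f n) \<le> ennreal (\<delta>/5)"
      and quot: "ennreal t * zeta c \<alpha> (f n) \<le> \<mu> (f n)" for n
      using f(1)[rule_format, of n] by (auto simp: F_def)
    define d where "d n = enn2real (ediam (f n))" for n
    have d: "ediam (f n) = ennreal (d n)" "0 \<le> d n" "d n \<le> \<delta>/5" for n
    proof -
      show eq: "ediam (f n) = ennreal (d n)"
        using diam[of n] by (auto simp: d_def top_unique intro!: ennreal_enn2real[symmetric] order_le_less_trans[OF diam])
      show "0 \<le> d n" by (simp add: d_def)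
      show "d n \<le> \<delta>/5" using diam[of n] \<delta> unfolding eq by simp
    qed
    define z where "z n = zeta c \<alpha> (f n)" for n
    have z: "z n = ennreal (c * d n powr \<alpha>)" for n
      unfolding z_def using d c by (intro zeta_ennreal) auto
    have tz: "ennreal t * (\<Sum>n. z n) \<le> \<mu> U"
    proof -
      have fc: "f n \<in> caratheodory_sets \<mu>" for n using closed car by auto
      have "ennreal t * (\<Sum>n. z n) = (\<Sum>n. ennreal t * z n)" by simp
      also have "\<dots> \<le> (\<Sum>n. \<mu> (f n))"
        using quot by (intro suminf_le) (auto simp: z_def)
      also have "\<dots> = (\<Sum>n. emeasure (caratheodory_measure \<mu>) (f n))"
        using fc by (simp add: emeasure_caratheodory_measure[OF om])
      also have "\<dots> = emeasure (caratheodory_measure \<mu>) (\<Union>n. f n)"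
        using fc f(2) by (intro suminf_emeasure) (auto simp: sets_caratheodory_measure[OF om])
      also have "\<dots> \<le> emeasure (caratheodory_measure \<mu>) U"
        using fU U car by (intro emeasure_mono) (auto simp: sets_caratheodory_measure[OF om])
      also have "\<dots> = \<mu> U"
        using U car by (intro emeasure_caratheodory_measure[OF om]) auto
      finally show ?thesis .
    qed
    have zfin: "(\<Sum>n. z n) \<noteq> top"
      using tz U t by (auto simp: ennreal_mult_top top_unique)
    have tail: "(\<lambda>n. \<Sum>k. z (k + n)) \<longlonglongrightarrow> 0"
      using ennreal_suminf_tail[OF zfin] .
    have "z n \<le> (\<Sum>k. z (k + n))" for n
      using sum_le_suminf[of "\<lambda>k. z (k + n)" "{0}"] by simp
    then have z0: "z \<longlonglongrightarrow> 0"
      by (intro tendsto_sandwich[OF _ _ tendsto_const tail]) auto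
    \<comment> \<open>A member of \<open>F\<close> missing every chosen set would remain available
      forever and force \<open>d n\<close> to be at least half its diameter for all
      \<open>n\<close>, against the convergence of \<open>z\<close> to 0.\<close>
    have meets: "\<exists>n. S \<inter> f n \<noteq> {}" if S: "S \<in> F" for S
    proof (rule ccontr)
      assume no: "\<nexists>n. S \<inter> f n \<noteq> {}"
      obtain s where s: "ediam S = ennreal s" "0 < s"
        using pos[OF S] Fdiam[rule_format, OF S] by (cases "ediam S") (auto simp: top_unique less_le)
      have "ennreal (c * (s/2) powr \<alpha>) \<le> z n" for n
      proof -
        have "S \<inter> (\<Union>i<n. f i) = {}" using no by blast
        from f(3)[rule_format, OF S this] have "ennreal s \<le> ennreal (2 * d n)"
          using s d by (simp add: ennreal_mult flip: ennreal_numeral)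
        then have "s/2 \<le> d n" using d(2)[of n] by (simp add: ennreal_le_iff)
        then show ?thesis
          unfolding z using s c \<alpha> by (intro ennreal_leI mult_left_mono powr_mono2) auto
      qed
      then have "ennreal (c * (s/2) powr \<alpha>) \<le> 0"
        by (intro LIMSEQ_le_const[OF z0]) auto
      then show False using s c by (auto simp: ennreal_eq_0_iff mult_le_0_iff)
    qed
    \<comment> \<open>Just before the first chosen set that meets \<open>S\<close>, the set
      \<open>S\<close> was still available, so its diameter is at most \<open>2 * d n\<close>; a
      common point then places \<open>S\<close> in the thickened set.\<close>
    have first: "\<exists>n. (\<forall>i<n. S \<inter> f i = {}) \<and> S \<inter> f n \<noteq> {} \<and> S \<subseteq> thicken (f n) (2 * d n)" if S: "S \<in> F" for S
    proof -
      define n where "n = (LEAST n. S \<inter> f n \<noteq> {})"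
      have n: "S \<inter> f n \<noteq> {}" unfolding n_def using meets[OF S] by (rule LeastI_ex)
      have before: "\<forall>i<n. S \<inter> f i = {}" unfolding n_def using not_less_Least by blast
      then have "ediam S \<le> 2 * ediam (f n)" using S by (intro f(3)[rule_format]) auto
      then have Sd: "ediam S \<le> ennreal (2 * d n)"
        using d by (simp add: ennreal_mult flip: ennreal_numeral)
      from n obtain p where p: "p \<in> S" "p \<in> f n" by blast
      have "S \<subseteq> cball p (2 * d n)"
      proof
        fix y assume "y \<in> S"
        from order_trans[OF dist_le_ediam[OF p(1) this] Sd] show "y \<in> cball p (2 * d n)"
          using d(2)[of n] by (simp add: ennreal_le_iff)
      qed
      then show ?thesis
        using n before cball_subset_thicken[OF p(2)] by blast
    qed
    have approx: "zeta_approx c \<alpha> \<delta> B \<le> (\<Sum>n. z n) + ennreal (5 powr \<alpha>) * (\<Sum>n. z (n + N))" for N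
    proof -
      define E where "E n = (if n < N then f n else thicken (f n) (2 * d n))" for n
      have diam5: "ediam (thicken (f n) (2 * d n)) \<le> ennreal (5 * d n)" for n
        using ediam_thicken[of "f n" "d n" "2 * d n"] d[of n] by simp
      have "B \<subseteq> (\<Union>n. E n)"
      proof
        fix x assume x: "x \<in> B"
        show "x \<in> (\<Union>n. E n)"
        proof (cases "x \<in> (\<Union>i<N. f i)")
          case True
          then obtain i where "i < N" "x \<in> f i" by blast
          then have "x \<in> E i" by (simp add: E_def)
          then show ?thesis by blast
        next
          case False
          \<comment> \<open>Finitely many closed sets are avoided by a neighbourhood of
            \<open>x\<close>, hence by some member of \<open>F\<close> containing \<open>x\<close>;
            the first chosen set it meets has index at least \<open>N\<close>.\<close>
          have "open (- (\<Union>i<N. f i))" using closed by (intro open_Compl closed_UN) auto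
          with False obtain S where S: "S \<in> F" "x \<in> S" "S \<subseteq> - (\<Union>i<N. f i)"
            using fine[OF x] by (metis ComplI)
          from first[OF S(1)] obtain n where n: "S \<inter> f n \<noteq> {}" "S \<subseteq> thicken (f n) (2 * d n)" by blast
          then have "\<not> n < N" using S(3) by auto
          with n S(2) have "x \<in> E n" by (auto simp: E_def)
          then show ?thesis by blast
        qed
      qed
      moreover have "ediam (E n) \<le> ennreal \<delta>" for n
      proof -
        have "ennreal (d n) \<le> ennreal \<delta>" "ennreal (5 * d n) \<le> ennreal \<delta>"
          using d(2,3)[of n] \<delta> by (auto intro!: ennreal_leI)
        then show ?thesis
          using diam5[of n] d(1)[of n] by (auto simp: E_def intro: order_trans)
      qed
      ultimately have "zeta_approx c \<alpha> \<delta> B \<le> (\<Sum>n. zeta c \<alpha> (E n))"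
        using closed by (intro zeta_approx_le) (auto simp: E_def)
      also have "\<dots> = (\<Sum>n. zeta c \<alpha> (E (n + N))) + (\<Sum>n<N. zeta c \<alpha> (E n))"
        by (rule suminf_offset) simp
      also have "(\<Sum>n<N. zeta c \<alpha> (E n)) = (\<Sum>n<N. z n)"
        by (intro sum.cong) (auto simp: E_def z_def)
      also have "\<dots> \<le> (\<Sum>n. z n)"
        by (intro sum_le_suminf) auto
      also have "(\<Sum>n. zeta c \<alpha> (E (n + N))) \<le> (\<Sum>n. ennreal (5 powr \<alpha>) * z (n + N))"
      proof (intro suminf_le)
        fix n
        have "zeta c \<alpha> (E (n + N)) \<le> ennreal (c * (5 * d (n + N)) powr \<alpha>)"
          unfolding E_def using diam5 d c \<alpha> by (auto intro!: zeta_le)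
        also have "\<dots> = ennreal (5 powr \<alpha>) * z (n + N)"
          using c d by (simp add: z powr_mult ennreal_mult[symmetric] mult_ac)
        finally show "zeta c \<alpha> (E (n + N)) \<le> ennreal (5 powr \<alpha>) * z (n + N)" .
      qed auto
      finally show ?thesis by (simp add: add.commute add_mono)
    qed
    have "(\<lambda>N. (\<Sum>n. z n) + ennreal (5 powr \<alpha>) * (\<Sum>n. z (n + N))) \<longlonglongrightarrow> (\<Sum>n. z n) + ennreal (5 powr \<alpha>) * 0"
      by (intro tendsto_add tendsto_const ennreal_tendsto_cmult tail) auto
    then have "zeta_approx c \<alpha> \<delta> B \<le> (\<Sum>n. z n) + ennreal (5 powr \<alpha>) * 0"
      by (rule LIMSEQ_le_const) (use approx in auto)
    then have "ennreal t * zeta_approx c \<alpha> \<delta> B \<le> ennreal t * (\<Sum>n. z n)"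
      by (intro mult_left_mono) auto
    with tz show ?thesis by (rule order_trans[rotated])
  qed
  then show ?thesis
    unfolding hausdorff_def SUP_mult_left_ennreal by (intro SUP_least) auto
qed

text \<open>Restricted to \<open>U\<close>, the measure is finite and hence outer regular, so
  \<open>B\<close> has an open neighbourhood inside \<open>U\<close> of measure at most
  \<open>\<mu> B + e\<close>. The Vitali estimate is applied in that neighbourhood.\<close>

lemma hausdorff_le_of_density_greater:
  fixes \<mu> :: "'a::metric_space set \<Rightarrow> ennreal" and t :: real
  assumes "0 < \<alpha>" "0 < c" "0 < t"
    and om: "outer_measure_space UNIV \<mu>" and car: "sets borel \<subseteq> caratheodory_sets \<mu>"
    and U: "open U" "\<mu> U < \<infinity>" and B: "B \<in> sets borel" "B \<subseteq> U"
    and "\<And>x. x \<in> B \<Longrightarrow> ennreal t < federer_density c \<alpha> \<mu> x"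
    and "\<And>x. x \<in> B \<Longrightarrow> \<mu> {x} = 0"
  shows "ennreal t * hausdorff c \<alpha> B \<le> \<mu> B"
proof (rule ennreal_le_epsilon)
  fix e :: real assume e: "0 < e"
  define M where "M = borel_restriction \<mu> U"
  have em: "emeasure M S = \<mu> (U \<inter> S)" if "S \<in> sets borel" for S
    unfolding M_def using om car U that by (intro emeasure_borel_restriction) auto
  have "finite_measure M"
    using U em[of UNIV] by (intro finite_measureI) (auto simp: M_def)
  then obtain C V where V: "closed C" "open V" "C \<subseteq> B" "B \<subseteq> V" "emeasure M (V - C) < ennreal e"
    using finite_borel_measure_regular[of M B e] B e by (auto simp: M_def)
  have "ennreal t * hausdorff c \<alpha> B \<le> \<mu> (U \<inter> V)"
    using assms V outer_measure_mono[OF om, of "U \<inter> V" U]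
    by (intro hausdorff_le_of_density_greater_open) auto
  also have "\<dots> \<le> \<mu> (B \<union> U \<inter> (V - C))"
    using V by (intro outer_measure_mono[OF om]) auto
  also have "\<dots> \<le> \<mu> B + \<mu> (U \<inter> (V - C))"
    by (rule outer_measure_Un[OF om])
  also have "\<dots> \<le> \<mu> B + ennreal e"
    using V em[of "V - C"] by (intro add_left_mono) auto
  finally show "ennreal t * hausdorff c \<alpha> B \<le> \<mu> B + ennreal e" .
qed

subsection \<open>The integral representation\<close>

text \<open>If \<open>f < g\<close> held on a part of \<open>E\<close> of positive measure, the
  integrals would be strictly ordered. Finiteness of the smaller one is essential, since otherwise
  both could be infinite.\<close>

lemma AE_le_of_set_nn_integral_le:
  assumes [measurable]: "E \<in> sets M" "f \<in> borel_measurable M" "g \<in> borel_measurable M"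
    and less: "\<And>x. x \<in> E \<Longrightarrow> f x < g x"
    and fin: "(\<integral>\<^sup>+x\<in>E. f x \<partial>M) \<noteq> \<infinity>" and le: "(\<integral>\<^sup>+x\<in>E. g x \<partial>M) \<le> (\<integral>\<^sup>+x\<in>E. f x \<partial>M)"
  shows "AE x in M. x \<notin> E"
proof -
  have "AE x in M. g x * indicator E x \<le> f x * indicator E x"
  proof (rule ccontr)
    assume not: "\<not> ?thesis"
    have "AE x in M. f x * indicator E x \<le> g x * indicator E x"
      by (intro AE_I2) (auto simp: indicator_def intro: less_imp_le less)
    from nn_integral_less[OF _ _ fin this not] le show False by simp
  qed
  then show ?thesis
    by eventually_elim (use less in \<open>auto simp: indicator_def not_le[symmetric]\<close>)
qed

theorem theorem4:
  fixes \<alpha> c :: real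
    and \<mu> :: "'a::metric_space set \<Rightarrow> ennreal"
    and A :: "'a set"
  assumes "\<alpha> > 0" and "c > 0"
    and "borel_regular \<mu>"
    and "\<exists>\<U>. countable \<U> \<and> (\<forall>U\<in>\<U>. open U \<and> \<mu> U < \<infinity>) \<and> \<Union>\<U> = UNIV"
    and "A \<in> sets borel"
    and "covers_finely (gauge_family \<mu> (zeta c \<alpha>)) A"
  shows "federer_density c \<alpha> \<mu> \<in> borel_measurable (restrict_space borel A) \<and>
    (hausdorff c \<alpha> A < \<infinity> \<longrightarrow>
      outer_absolutely_continuous (outer_restriction \<mu> A) (outer_restriction (hausdorff c \<alpha>) A) \<longrightarrow>
      (\<forall>B\<in>sets borel. B \<subseteq> A \<longrightarrow>
        \<mu> B = (\<integral>\<^sup>+x\<in>B. federer_density c \<alpha> \<mu> x \<partial>caratheodory_measure (hausdorff c \<alpha>))))"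
proof (intro conjI impI ballI)
  note om = \<open>borel_regular \<mu>\<close>[unfolded borel_regular_def, THEN conjunct1]
  have car: "sets borel \<subseteq> caratheodory_sets \<mu>"
    using \<open>borel_regular \<mu>\<close> by (intro sets_borel_subset_caratheodory) (auto simp: borel_regular_def)
  note omH = outer_measure_space_hausdorff[of c \<alpha>, where 'a='a]
    and carH = sets_borel_subset_caratheodory_hausdorff[of c \<alpha>, where 'a='a]
  define s where "s = federer_density c \<alpha> \<mu>"
  have s [measurable]: "s \<in> borel_measurable borel"
    unfolding s_def using assms(1,2) outer_measure_mono[OF om]
    by (intro borel_measurable_federer_density) auto
  show "federer_density c \<alpha> \<mu> \<in> borel_measurable (restrict_space borel A)"
    using s unfolding s_def by (rule measurable_restrict_space1)
  fix B
  assume H: "hausdorff c \<alpha> A < \<infinity>"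
    and ac: "outer_absolutely_continuous (outer_restriction \<mu> A) (outer_restriction (hausdorff c \<alpha>) A)"
    and B [measurable]: "B \<in> sets borel" and "B \<subseteq> A"
  have [measurable]: "A \<in> sets borel" by fact
  define M where "M = borel_restriction (hausdorff c \<alpha>) A"
  define N where "N = borel_restriction \<mu> A"
  have [measurable_cong, simp]: "sets M = sets borel" "sets N = sets borel"
    by (simp_all add: M_def N_def)
  have M: "emeasure M E = hausdorff c \<alpha> (A \<inter> E)" and N: "emeasure N E = \<mu> (A \<inter> E)"
    if "E \<in> sets borel" for E
    unfolding M_def N_def using that om omH car carH \<open>A \<in> sets borel\<close>
    by (auto intro!: emeasure_borel_restriction)
  interpret finite_measure M
    using H M[of UNIV] by (intro finite_measureI) (auto simp: M_def)
  have null: "\<mu> (A \<inter> E) = 0" if "hausdorff c \<alpha> (A \<inter> E) = 0" for E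
    using ac that unfolding outer_absolutely_continuous_def outer_restriction_def by blast
  have atom: "\<mu> {x} = 0" if "x \<in> A" for x
    using null[of "{x}"] that by simp
  have "absolutely_continuous M N"
    unfolding absolutely_continuous_def using M N null by (auto simp: null_sets_def)
  \<comment> \<open>Finiteness is known only for \<open>M\<close>; \<open>N\<close> may be infinite,
    and \<open>h\<close> is an extended nonnegative function.\<close>
  then obtain h where h: "h \<in> borel_measurable M" and dens: "density M h = N"
    using Radon_Nikodym[of N] by auto
  from h have [measurable]: "h \<in> borel_measurable borel" by simp
  have Nh: "\<mu> E = (\<integral>\<^sup>+x\<in>E. h x \<partial>M)" if "E \<in> sets borel" "E \<subseteq> A" for E
  proof -
    have "\<mu> E = emeasure (density M h) E"
      using N[OF that(1)] that dens by (simp add: Int_absorb1)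
    also have "\<dots> = (\<integral>\<^sup>+x\<in>E. h x \<partial>M)"
      using that h by (intro emeasure_density) auto
    finally show ?thesis .
  qed
  have MH: "(\<integral>\<^sup>+x\<in>E. ennreal q \<partial>M) = ennreal q * hausdorff c \<alpha> E" if "E \<in> sets borel" "E \<subseteq> A" for E q
    using that M[OF that(1)] by (simp add: nn_integral_cmult_indicator Int_absorb1)
  have HE: "hausdorff c \<alpha> E < \<infinity>" if "E \<subseteq> A" for E
    using hausdorff_mono[OF that, of c \<alpha>] H by (auto intro: order_le_less_trans)

  have not_less: "AE x in M. \<not> (x \<in> A \<and> s x < ennreal q \<and> ennreal q < h x)" for q :: real
  proof (cases "0 < q")
    case True
    define E where "E = {x. x \<in> A \<and> s x < ennreal q \<and> ennreal q < h x}"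
    have E [measurable]: "E \<in> sets borel" unfolding E_def by measurable
    have EA: "E \<subseteq> A" by (auto simp: E_def)
    have le: "\<mu> E \<le> ennreal q * hausdorff c \<alpha> E"
      using assms(1,2) True om car E by (intro measure_le_of_density_less) (auto simp: E_def s_def)
    have "AE x in M. x \<notin> E"
    proof (rule AE_le_of_set_nn_integral_le)
      show "(\<integral>\<^sup>+x\<in>E. ennreal q \<partial>M) \<noteq> \<infinity>"
        using HE[OF EA] by (simp add: MH[OF E EA] ennreal_mult_eq_top_iff)
      show "(\<integral>\<^sup>+x\<in>E. h x \<partial>M) \<le> (\<integral>\<^sup>+x\<in>E. ennreal q \<partial>M)"
        using le by (simp add: MH[OF E EA] Nh[OF E EA, symmetric])
      show "ennreal q < h x" if "x \<in> E" for x
        using that by (simp add: E_def)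
    qed (use E h in simp_all)
    then show ?thesis unfolding E_def mem_Collect_eq .
  next
    \<comment> \<open>All rationals are quantified over later, including negative ones;
      \<open>ennreal\<close> sends these to 0, and no value lies below 0.\<close>
    case False
    then have "ennreal q = 0" by (intro ennreal_neg) simp
    then show ?thesis by simp
  qed

  from assms(4) obtain \<U> where \<U>: "countable \<U>" "\<forall>U\<in>\<U>. open U \<and> \<mu> U < \<infinity>" "\<Union>\<U> = UNIV"
    by (elim exE conjE)
  \<comment> \<open>The smaller integral is now that of \<open>h\<close>, which equals
    \<open>\<mu> E\<close>. It is finite once \<open>E\<close> is cut with a member of the open
    cover, and countability of the cover recombines the null sets.\<close>
  have not_greater: "AE x in M. \<not> (x \<in> A \<and> h x < ennreal q \<and> ennreal q < s x)" for q :: real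
  proof (cases "0 < q")
    case True
    have "AE x in M. \<forall>U\<in>\<U>. x \<notin> {x. x \<in> A \<inter> U \<and> h x < ennreal q \<and> ennreal q < s x}"
    proof (rule AE_ball_countable'[OF _ \<U>(1)])
      fix U assume "U \<in> \<U>"
      then have U: "open U" "\<mu> U < \<infinity>" using \<U>(2) by auto
      define E where "E = {x. x \<in> A \<inter> U \<and> h x < ennreal q \<and> ennreal q < s x}"
      have [measurable]: "U \<in> sets borel" using U by simp
      have E [measurable]: "E \<in> sets borel" unfolding E_def by measurable
      have EA: "E \<subseteq> A" and EU: "E \<subseteq> U" by (auto simp: E_def)
      have le: "ennreal q * hausdorff c \<alpha> E \<le> \<mu> E"
        by (rule hausdorff_le_of_density_greater[OF assms(1,2) True om car U E EU])
           (simp_all add: E_def s_def[symmetric] atom)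
      have "AE x in M. x \<notin> E"
      proof (rule AE_le_of_set_nn_integral_le)
        show "(\<integral>\<^sup>+x\<in>E. h x \<partial>M) \<noteq> \<infinity>"
          using order_le_less_trans[OF outer_measure_mono[OF om EU] U(2)]
          by (simp add: Nh[OF E EA, symmetric])
        show "(\<integral>\<^sup>+x\<in>E. ennreal q \<partial>M) \<le> (\<integral>\<^sup>+x\<in>E. h x \<partial>M)"
          using le by (simp add: MH[OF E EA] Nh[OF E EA, symmetric])
        show "h x < ennreal q" if "x \<in> E" for x
          using that by (simp add: E_def)
      qed (use E h in simp_all)
      then show "AE x in M. x \<notin> {x. x \<in> A \<inter> U \<and> h x < ennreal q \<and> ennreal q < s x}"
        unfolding E_def .
    qed
    then show ?thesis
    proof eventually_elim
      case (elim x)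
      obtain U where "U \<in> \<U>" "x \<in> U" using \<U>(3) by (metis UNIV_I UnionE)
      with elim show ?case by blast
    qed
  next
    case False
    then have "ennreal q = 0" by (intro ennreal_neg) simp
    then show ?thesis by simp
  qed

  have "AE x in M. \<forall>r::rat. \<not> (x \<in> A \<and> s x < ennreal (real_of_rat r) \<and> ennreal (real_of_rat r) < h x)"
    unfolding AE_all_countable using not_less by blast
  moreover have "AE x in M. \<forall>r::rat. \<not> (x \<in> A \<and> h x < ennreal (real_of_rat r) \<and> ennreal (real_of_rat r) < s x)"
    unfolding AE_all_countable using not_greater by blast
  ultimately have AE: "AE x in M. x \<in> A \<longrightarrow> h x = s x"
  proof eventually_elim
    case (elim x)
    then show ?case
      using ennreal_rat_dense[of "h x" "s x"] ennreal_rat_dense[of "s x" "h x"]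
      by (metis linorder_neqE)
  qed
  have "\<mu> B = (\<integral>\<^sup>+x\<in>B. h x \<partial>M)"
    using \<open>B \<subseteq> A\<close> by (intro Nh) auto
  also have "\<dots> = (\<integral>\<^sup>+x\<in>B. s x \<partial>M)"
    using AE \<open>B \<subseteq> A\<close> by (intro nn_integral_cong_AE) (auto elim!: eventually_mono simp: indicator_def)
  also have "\<dots> = (\<integral>\<^sup>+x\<in>A. (s x * indicator B x) \<partial>caratheodory_measure (hausdorff c \<alpha>))"
    unfolding M_def using omH carH by (intro nn_integral_borel_restriction) auto
  also have "\<dots> = (\<integral>\<^sup>+x\<in>B. s x \<partial>caratheodory_measure (hausdorff c \<alpha>))"
    using \<open>B \<subseteq> A\<close> by (intro nn_integral_cong) (auto simp: indicator_def)
  finally show "\<mu> B = (\<integral>\<^sup>+x\<in>B. federer_density c \<alpha> \<mu> x \<partial>caratheodory_measure (hausdorff c \<alpha>))"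
    by (simp add: s_def)
qed

end
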